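(* Let $\widehat\Pi$ and $\Pi$ be Gorenstein* posets of rank $n$ and let $\phi:\widehat\Pi\to\Pi$ be a subdivision. For $\sigma\in\Pi$ write $\widehat\sigma=\phi^{-1}[\hat0,\sigma]$ and $\partial\widehat\sigma=\phi^{-1}[\hat0,\sigma)$, so that $(\widehat\sigma,\partial\widehat\sigma)$ is near-Gorenstein* with $\mathbf c\mathbf d$-index $\Psi_{\widehat\sigma}=\Phi_{\widehat\sigma}+\Psi_{\partial\widehat\sigma}$. Then \[\Psi_{\widehat\Pi}=\sum_{\sigma\in\Pi}\Phi_{\widehat\sigma}\cdot\Psi_{[\sigma,\hat1)}.\]
   Context: Conventions: all posets are finite and graded, have a minimum $\hat0$ of rank $0$, and need not have a maximum; in a poset of rank $n$ all maximal elements have rank $n$. $\rho$ is rank; $\hat1$ is a formally adjoined maximum of rank $n+1$; $[\sigma,\hat1)$ is the set of elements $\ge\sigma$, regarded as a graded poset with minimum $\sigma$. Order complex: $\mathcal O(\Pi)$ is the simplicial complex whose faces are the chains in $\Pi\setminus\{\hat0\}$. A simplicial complex $\Delta$ of dimension $n-1$ is Gorenstein if for every face $x$ (including the empty face, of dimension $-1$, with link $\Delta$) $\tilde H_i(\mathrm{Link}_\Delta(x);\mathbb R)$ is $\mathbb R$ for $i=n-2-\dim x$ and $0$ otherwise. A pair $(\Delta,\partial\Delta)$ with $\partial\Delta$ a subcomplex of dimension $n-2$ is near-Gorenstein if $\partial\Delta$ is Gorenstein of dimension $n-2$ and for every face $x$ of $\Delta$ (including the empty face) $\tilde H_i(\mathrm{Link}_\Delta(x);\mathbb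 R)$ is $\mathbb R$ if $i=n-2-\dim x$ and $x\notin\partial\Delta$, and $0$ otherwise. A poset is Gorenstein* if its order complex is Gorenstein. A pair $(P,\partial P)$, with $P$ of rank $m$ and $\partial P\subset P$ a down-closed subposet of rank $m-1$, is near-Gorenstein* of rank $m$ if $(\mathcal O(P),\mathcal O(\partial P))$ is near-Gorenstein. $\mathbf{a}\mathbf{b}$-index: for a chain $x=\{\hat0=\sigma_0<\cdots<\sigma_k\}$ in a poset $P$ of rank $m$, $\mathrm{wt}(x)=(\mathbf a-\mathbf b)^{\rho(\sigma_0,\sigma_1)-1}\mathbf b\cdots\mathbf b(\mathbf a-\mathbf b)^{\rho(\sigma_k,\hat1)-1}$ with $\rho(\hat1)=m+1$, and $\Psi_P=\sum_x\mathrm{wt}(x)$. For Gorenstein* (hence Eulerian) $P$ it is a polynomial in $\mathbf c=\mathbf a+\mathbf b$, $\mathbf d=\mathbf a\mathbf b+\mathbf b\mathbf a$, the $\mathbf c\mathbf d$-index. For a near-Gorenstein* pair $(P,\partial P)$ of rank $m$ one has $\Psi_P(\mathbf a,\mathbf b)=\Phi_P(\mathbf a,\mathbf b)+\Psi_{\partial P}(\mathbf a,\mathbf b)\,\mathbf a$ with $\Phi_P$ homogeneous of degree $m$ and expressible in $\mathbf c,\mathbf d$; the $\mathbf c\mathbf d$-index of $P$ is $\Psi_P(\mathbf c,\mathbf d):=\Phi_P(\mathbf c,\mathbf d)+\Psi_{\partial P}(\mathbf c,\mathbf d)$. Subdivision: for Gorenstein* posets $\widehat\Pi,\Pi$ of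 rank $n$, a surjective order-preserving (not necessarily rank-preserving) map $\phi:\widehat\Pi\to\Pi$ is a subdivision if for every $\sigma\in\Pi$ the pair $(\phi^{-1}[\hat0,\sigma],\phi^{-1}[\hat0,\sigma))$ is near-Gorenstein* of rank $\rho(\sigma)$. *)

theory Defs
  imports Complex_Main "HOL-Library.Poly_Mapping"
begin

section \<open>Noncommutative polynomials\<close>

text \<open>
  The free monoid on \<open>'x\<close>, written additively because the convolution product of
  \<open>Poly_Mapping\<close> adds exponents. Hence \<open>'x word \<Rightarrow>\<^sub>0 int\<close> is the free
  associative ring on \<open>'x\<close>.
\<close>

datatype 'x word = Word (letters: "'x list")

instantiation word :: (type) monoid_add
begin

definition zero_word :: "'a word" where
  "zero_word = Word []"

definition plus_word :: "'a word \<Rightarrow> 'a word \<Rightarrow> 'a word" where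
  "plus_word u v = Word (letters u @ letters v)"

instance
  by standard (simp_all add: zero_word_def plus_word_def)

end

datatype ab = A | B
datatype cd = C | D

type_synonym ab_poly = "ab word \<Rightarrow>\<^sub>0 int"
type_synonym cd_poly = "cd word \<Rightarrow>\<^sub>0 int"

definition pa :: ab_poly where "pa = Poly_Mapping.single (Word [A]) 1"
definition pb :: ab_poly where "pb = Poly_Mapping.single (Word [B]) 1"

fun cd_letter :: "cd \<Rightarrow> ab_poly" where
  "cd_letter C = pa + pb"
| "cd_letter D = pa * pb + pb * pa"

text \<open>The ring homomorphism substituting \<open>c = a + b\<close> and \<open>d = ab + ba\<close>.\<close>

definition cd_subst :: "cd_poly \<Rightarrow> ab_poly" where
  "cd_subst q = (\<Sum>w\<in>Poly_Mapping.keys q.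
      of_int (Poly_Mapping.lookup q w) * prod_list (map cd_letter (letters w)))"

text \<open>
  The expression of an \<open>ab\<close>-polynomial in \<open>c\<close> and \<open>d\<close>. The substitution is injective, so
  this is meaningful exactly when such an expression exists.
\<close>

definition to_cd :: "ab_poly \<Rightarrow> cd_poly" where
  "to_cd p = (THE q. cd_subst q = p)"


section \<open>Reduced simplicial homology with real coefficients\<close>

text \<open>
  A finite abstract simplicial complex is its set of faces, the empty face included. The void
  complex \<open>{}\<close>, without even the empty face, is admitted and has dimension \<open>-2\<close>; it is
  the boundary in the near-Gorenstein pair of dimension \<open>-1\<close>.
\<close>

definition abs_complex :: "'v set set \<Rightarrow> bool" where
  "abs_complex \<Delta> \<longleftrightarrow> finite \<Delta> \<and> (\<forall>x\<in>\<Delta>. finite x \<and> (\<forall>y. y \<subseteq> x \<longrightarrow> y \<in> \<Delta>))"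

definition face_dim :: "'v set \<Rightarrow> int" where
  "face_dim x = int (card x) - 1"

definition complex_dim :: "'v set set \<Rightarrow> int" where
  "complex_dim \<Delta> = (if \<Delta> = {} then -2 else Max (face_dim ` \<Delta>))"

definition link :: "'v set set \<Rightarrow> 'v set \<Rightarrow> 'v set set" where
  "link \<Delta> x = {y \<in> \<Delta>. x \<inter> y = {} \<and> x \<union> y \<in> \<Delta>}"

text \<open>
  An oriented \<open>i\<close>-chain is encoded by its coefficients on all oriented simplices
  \<open>[v\<^sub>0, \<dots>, v\<^sub>i]\<close>, that is, as an alternating function of the vertex list (lists with a
  repeated entry get coefficient \<open>0\<close>). The empty list carries the augmentation in degree \<open>-1\<close>.
\<close>

definition chains :: "'v set set \<Rightarrow> int \<Rightarrow> ('v list \<Rightarrow> real) set" where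
  "chains \<Delta> i = {c.
      (\<forall>xs. c xs \<noteq> 0 \<longrightarrow> int (length xs) = i + 1 \<and> set xs \<in> \<Delta>) \<and>
      (\<forall>xs u v ys. c (xs @ u # v # ys) = - c (xs @ v # u # ys))}"

text \<open>
  The usual boundary in these coordinates: the coefficient of \<open>[v\<^sub>0, \<dots>, v\<^sub>i]\<close> with \<open>v\<^sub>j\<close>
  omitted in the boundary of \<open>[v\<^sub>0, \<dots>, v\<^sub>i]\<close> is the sign of moving \<open>v\<^sub>j\<close> to the front,
  which is \<open>(-1)^j\<close>.
\<close>

definition boundary :: "'v set set \<Rightarrow> ('v list \<Rightarrow> real) \<Rightarrow> ('v list \<Rightarrow> real)" where
  "boundary \<Delta> c = (\<lambda>xs. \<Sum>v\<in>\<Union>\<Delta>. c (v # xs))"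

definition cycles :: "'v set set \<Rightarrow> int \<Rightarrow> ('v list \<Rightarrow> real) set" where
  "cycles \<Delta> i = {c \<in> chains \<Delta> i. boundary \<Delta> c = (\<lambda>_. 0)}"

definition boundaries :: "'v set set \<Rightarrow> int \<Rightarrow> ('v list \<Rightarrow> real) set" where
  "boundaries \<Delta> i = boundary \<Delta> ` chains \<Delta> (i + 1)"

definition hom_class :: "'v set set \<Rightarrow> int \<Rightarrow> ('v list \<Rightarrow> real) \<Rightarrow> ('v list \<Rightarrow> real) set" where
  "hom_class \<Delta> i z = {z' \<in> cycles \<Delta> i. (\<lambda>xs. z' xs - z xs) \<in> boundaries \<Delta> i}"

definition red_homology :: "'v set set \<Rightarrow> int \<Rightarrow> ('v list \<Rightarrow> real) set set" where
  "red_homology \<Delta> i = hom_class \<Delta> i ` cycles \<Delta> i"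

definition homology_zero :: "'v set set \<Rightarrow> int \<Rightarrow> bool" where
  "homology_zero \<Delta> i \<longleftrightarrow> red_homology \<Delta> i = {hom_class \<Delta> i (\<lambda>_. 0)}"

text \<open>Isomorphic to \<open>\<real>\<close> as a real vector space.\<close>

definition homology_real :: "'v set set \<Rightarrow> int \<Rightarrow> bool" where
  "homology_real \<Delta> i \<longleftrightarrow> (\<exists>f :: ('v list \<Rightarrow> real) set \<Rightarrow> real.
      bij_betw f (red_homology \<Delta> i) UNIV \<and>
      (\<forall>z\<in>cycles \<Delta> i. \<forall>w\<in>cycles \<Delta> i.
         f (hom_class \<Delta> i (\<lambda>xs. z xs + w xs)) = f (hom_class \<Delta> i z) + f (hom_class \<Delta> i w)) \<and>
      (\<forall>r. \<forall>z\<in>cycles \<Delta> i.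
         f (hom_class \<Delta> i (\<lambda>xs. r * z xs)) = r * f (hom_class \<Delta> i z)))"


section \<open>Gorenstein complexes and near-Gorenstein pairs\<close>

text \<open>The parameter \<open>e\<close> is the dimension; it is \<open>n - 1\<close> for the order complex of a poset of rank \<open>n\<close>.\<close>

definition gorenstein :: "int \<Rightarrow> 'v set set \<Rightarrow> bool" where
  "gorenstein e \<Delta> \<longleftrightarrow> abs_complex \<Delta> \<and> complex_dim \<Delta> = e \<and>
     (\<forall>x\<in>\<Delta>. \<forall>i. if i = e - 1 - face_dim x then homology_real (link \<Delta> x) i
                   else homology_zero (link \<Delta> x) i)"

definition near_gorenstein :: "int \<Rightarrow> 'v set set \<Rightarrow> 'v set set \<Rightarrow> bool" where
  "near_gorenstein e \<Delta> \<Gamma> \<longleftrightarrow> abs_complex \<Delta> \<and> complex_dim \<Delta> = e \<and>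
     \<Gamma> \<subseteq> \<Delta> \<and> gorenstein (e - 1) \<Gamma> \<and>
     (\<forall>x\<in>\<Delta>. \<forall>i. if i = e - 1 - face_dim x \<and> x \<notin> \<Gamma> then homology_real (link \<Delta> x) i
                   else homology_zero (link \<Delta> x) i)"


section \<open>Graded posets\<close>

text \<open>
  A finite poset is a finite subset of an arbitrary ordered type with the induced order. All
  notions below are intrinsic to the subset; in particular ranks are measured from its own minimum.
\<close>

definition bottom :: "'a::order set \<Rightarrow> 'a" where
  "bottom P = (LEAST x. x \<in> P)"

definition rk :: "'a::order set \<Rightarrow> 'a \<Rightarrow> nat" where
  "rk P x = Max (card ` {K. K \<subseteq> {y \<in> P. y < x} \<and> Complete_Partial_Order.chain (\<le>) K})"

definition poset_rank :: "'a::order set \<Rightarrow> nat" where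
  "poset_rank P = Max (rk P ` P)"

definition covers :: "'a::order set \<Rightarrow> 'a \<Rightarrow> 'a \<Rightarrow> bool" where
  "covers P x y \<longleftrightarrow> x \<in> P \<and> y \<in> P \<and> x < y \<and> \<not> (\<exists>z\<in>P. x < z \<and> z < y)"

definition graded_poset :: "nat \<Rightarrow> 'a::order set \<Rightarrow> bool" where
  "graded_poset n P \<longleftrightarrow> finite P \<and> (\<exists>z\<in>P. \<forall>x\<in>P. z \<le> x) \<and>
     (\<forall>x y. covers P x y \<longrightarrow> rk P y = rk P x + 1) \<and>
     (\<forall>x\<in>P. \<not> (\<exists>y\<in>P. x < y) \<longrightarrow> rk P x = n)"

text \<open>The order complex of the empty poset is the void complex.\<close>

definition order_complex :: "'a::order set \<Rightarrow> 'a set set" where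
  "order_complex P =
     {K. P \<noteq> {} \<and> K \<subseteq> P - {bottom P} \<and> Complete_Partial_Order.chain (\<le>) K}"

definition gorenstein_star :: "nat \<Rightarrow> 'a::order set \<Rightarrow> bool" where
  "gorenstein_star n P \<longleftrightarrow> graded_poset n P \<and> gorenstein (int n - 1) (order_complex P)"

text \<open>
  In rank \<open>0\<close> the boundary, of rank \<open>-1\<close>, is the empty poset. This is the case of
  the preimage of the minimum under a subdivision.
\<close>

definition near_gorenstein_star :: "nat \<Rightarrow> 'a::order set \<Rightarrow> 'a set \<Rightarrow> bool" where
  "near_gorenstein_star m P Q \<longleftrightarrow> graded_poset m P \<and> Q \<subseteq> P \<and>
     (\<forall>x\<in>Q. \<forall>y\<in>P. y \<le> x \<longrightarrow> y \<in> Q) \<and>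
     (if m = 0 then Q = {} else graded_poset (m - 1) Q) \<and>
     near_gorenstein (int m - 1) (order_complex P) (order_complex Q)"


section \<open>The ab-index and the cd-index\<close>

text \<open>A chain \<open>0 = \<sigma>\<^sub>0 < \<dots> < \<sigma>\<^sub>k\<close> is the list of its elements in increasing order.\<close>

definition rooted_chains :: "'a::order set \<Rightarrow> 'a list set" where
  "rooted_chains P = {xs. xs \<noteq> [] \<and> set xs \<subseteq> P \<and> sorted_wrt (<) xs \<and> hd xs = bottom P}"

fun chain_wt :: "'a::order set \<Rightarrow> 'a list \<Rightarrow> ab_poly" where
  "chain_wt P [] = 1"
| "chain_wt P [x] = (pa - pb) ^ (poset_rank P + 1 - rk P x - 1)"
| "chain_wt P (x # y # xs) = (pa - pb) ^ (rk P y - rk P x - 1) * pb * chain_wt P (y # xs)"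

definition ab_index :: "'a::order set \<Rightarrow> ab_poly" where
  "ab_index P = (\<Sum>xs\<in>rooted_chains P. chain_wt P xs)"

definition cd_index :: "'a::order set \<Rightarrow> cd_poly" where
  "cd_index P = to_cd (ab_index P)"

text \<open>The part \<open>\<Phi>\<^sub>P\<close> of the \<open>cd\<close>-index \<open>\<Phi>\<^sub>P + \<Psi>\<^sub>Q\<close> of a near-Gorenstein* pair \<open>(P, Q)\<close>, where \<open>Q\<close> is the boundary.\<close>

definition cd_Phi :: "'a::order set \<Rightarrow> 'a set \<Rightarrow> cd_poly" where
  "cd_Phi P Q = to_cd (ab_index P - ab_index Q * pa)"


section \<open>Subdivisions\<close>

definition closed_preimage :: "('a::order \<Rightarrow> 'b::order) \<Rightarrow> 'a set \<Rightarrow> 'b \<Rightarrow> 'a set" where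
  "closed_preimage \<phi> P' \<sigma> = {x \<in> P'. \<phi> x \<le> \<sigma>}"

definition open_preimage :: "('a::order \<Rightarrow> 'b::order) \<Rightarrow> 'a set \<Rightarrow> 'b \<Rightarrow> 'a set" where
  "open_preimage \<phi> P' \<sigma> = {x \<in> P'. \<phi> x < \<sigma>}"

definition subdivision :: "nat \<Rightarrow> ('a::order \<Rightarrow> 'b::order) \<Rightarrow> 'a set \<Rightarrow> 'b set \<Rightarrow> bool" where
  "subdivision n \<phi> P' P \<longleftrightarrow> gorenstein_star n P' \<and> gorenstein_star n P \<and>
     \<phi> ` P' = P \<and> mono_on P' \<phi> \<and>
     (\<forall>\<sigma>\<in>P. near_gorenstein_star (rk P \<sigma>) (closed_preimage \<phi> P' \<sigma>) (open_preimage \<phi> P' \<sigma>))"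

definition upper_set :: "'a::order set \<Rightarrow> 'a \<Rightarrow> 'a set" where
  "upper_set P \<sigma> = {\<tau> \<in> P. \<sigma> \<le> \<tau>}"

end

theory Submission
  imports Defs "HOL-Library.Function_Algebras" "HOL-Library.Multiset"
begin

text \<open>
  The identity of \<open>ab\<close>-polynomials behind the theorem is formal: it only needs the grading and the
  recursion \<open>\<Psi>\<^bsub>[x,1)\<^esub> = (a-b)^(\<rho>(x,1)-1) + \<Sum>\<^bsub>z > x\<^esub> (a-b)^(\<rho>(x,z)-1) b \<Psi>\<^bsub>[z,1)\<^esub>\<close>, which makes the sum over
  \<open>\<sigma>\<close> telescope. The homological hypotheses enter because every polynomial involved must lie in the
  image of the injective substitution \<open>c = a + b\<close>, \<open>d = ab + ba\<close>. Homology determines the Euler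
  characteristics of the links of faces; the link of a chain that is saturated outside an interval is
  the order complex of that open interval, so the poset is Eulerian, with a correction along the boundary of a
  near-Gorenstein* pair. Eulerian relations make the recursion symmetric in \<open>a\<close> and \<open>b\<close>. Adding the
  two versions shows that twice the \<open>ab\<close>-index is a polynomial in \<open>c\<close> and \<open>d\<close>, and divisibility by 2
  passes through the substitution.
\<close>

section \<open>Polynomials in c and d\<close>

text \<open>\<open>to_cd\<close> is a definite description and carries no information outside the
  image of \<open>cd_subst\<close>. An identity of ab-polynomials therefore transfers only once
  every factor on the right lies in that image; the identity itself then yields the preimage of the
  left side. Averaging the two recursions works by parity. With e = a - b, a step across rank
  distance k + 1 gets the coefficient e^k b + (-e)^k a, which is e^k c for even k and -e^(k+1) for
  odd k, and e^2 = c^2 - 2d. The telescoping has to cope with a map \<phi> that need not preserve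
  ranks. The closed preimage of \<phi>(y) has rank \<rho>(\<phi>(y)), so y has at most that rank in
  the source. Hence the last power of e in the weight of a flag ending over t splits into one factor
  fixed by the flag and t, and one fixed by t and the rank of the surrounding poset. The sums of the
  first kind are the same for the closed preimages, the open preimages and the whole source.\<close>

lemma poly_mapping_add_induct [case_names single add]:
  fixes p :: "'x \<Rightarrow>\<^sub>0 'y::comm_monoid_add"
  assumes single: "\<And>w k. P (Poly_Mapping.single w k)"
    and add: "\<And>p q. P p \<Longrightarrow> P q \<Longrightarrow> P (p + q)"
  shows "P p"
proof -
  have sum: "P (sum f S)" if "finite S" "\<And>w. w \<in> S \<Longrightarrow> P (f w)" for S and f :: "'x \<Rightarrow> 'x \<Rightarrow>\<^sub>0 'y"
    using that
  proof (induction S rule: finite_induct)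
    case empty
    \<comment> \<open>The zero polynomial is the monomial with coefficient 0, so the induction needs
      no base case of its own.\<close>
    show ?case using single[of undefined 0] by simp
  qed (simp add: add)
  have "p = (\<Sum>w\<in>Poly_Mapping.keys p. Poly_Mapping.single w (Poly_Mapping.lookup p w))"
    by (rule poly_mapping_eqI)
      (auto simp: lookup_sum lookup_single when_def in_keys_iff)
  with sum[of "Poly_Mapping.keys p" "\<lambda>w. Poly_Mapping.single w (Poly_Mapping.lookup p w)"] single
  show ?thesis by simp
qed

definition cd_monom :: "cd word \<Rightarrow> ab_poly" where
  "cd_monom w = prod_list (map cd_letter (letters w))"

lemma cd_monom_plus: "cd_monom (u + v) = cd_monom u * cd_monom v"
  by (simp add: cd_monom_def plus_word_def)

lemma cd_subst_superset:
  assumes "finite W" "Poly_Mapping.keys q \<subseteq> W"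
  shows "cd_subst q = (\<Sum>w\<in>W. of_int (Poly_Mapping.lookup q w) * cd_monom w)"
  unfolding cd_subst_def cd_monom_def
  by (rule sum.mono_neutral_left) (use assms in \<open>auto simp: in_keys_iff\<close>)

lemma cd_subst_add: "cd_subst (p + q) = cd_subst p + cd_subst q"
proof -
  let ?W = "Poly_Mapping.keys p \<union> Poly_Mapping.keys q"
  have "cd_subst r = (\<Sum>w\<in>?W. of_int (Poly_Mapping.lookup r w) * cd_monom w)"
    if "r \<in> {p, q, p + q}" for r
    using that Poly_Mapping.keys_add[of p q] by (intro cd_subst_superset) auto
  then show ?thesis
    by (simp add: lookup_add algebra_simps sum.distrib)
qed

lemma cd_subst_single: "cd_subst (Poly_Mapping.single w k) = of_int k * cd_monom w"
  by (subst cd_subst_superset[of "{w}"]) (auto simp: lookup_single)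

lemma cd_subst_zero [simp]: "cd_subst 0 = 0"
  by (simp add: cd_subst_def)

lemma cd_subst_uminus: "cd_subst (- p) = - cd_subst p"
  by (metis add.right_inverse add_eq_0_iff cd_subst_add cd_subst_zero)

lemma cd_subst_mult: "cd_subst (p * q) = cd_subst p * cd_subst q"
proof (induction p rule: poly_mapping_add_induct)
  case (single u k)
  show ?case
  proof (induction q rule: poly_mapping_add_induct)
    case (single v l)
    \<comment> \<open>Integers are central; this is the only commutation available in the free
      ring.\<close>
    have "of_int (k * l) * (cd_monom u * cd_monom v) = of_int k * cd_monom u * (of_int l * cd_monom v)"
      by (simp add: mult.assoc) (metis mult.assoc mult_of_int_commute)
    then show ?case
      by (simp add: mult_single cd_subst_single cd_monom_plus)
  qed (simp add: algebra_simps cd_subst_add)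
qed (simp add: algebra_simps cd_subst_add)

lemma cd_subst_sum: "cd_subst (\<Sum>i\<in>S. f i) = (\<Sum>i\<in>S. cd_subst (f i))"
  by (induction S rule: infinite_finite_induct) (simp_all add: cd_subst_add)

text \<open>The left cofactor of a letter: \<open>left_deriv A p\<close> and
  \<open>left_deriv B p\<close> are the unique q and r with p = k + a q + b r for an integer
  k.\<close>

definition left_deriv :: "ab \<Rightarrow> ab_poly \<Rightarrow> ab_poly" where
  "left_deriv x = Poly_Mapping.map_key (\<lambda>v. Word [x] + v)"

lemma lookup_left_deriv:
  "Poly_Mapping.lookup (left_deriv x p) v = Poly_Mapping.lookup p (Word [x] + v)"
proof -
  have "inj (\<lambda>v. Word [x] + v)" by (auto simp: inj_def plus_word_def word.expand)
  then show ?thesis by (simp add: left_deriv_def map_key.rep_eq)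
qed

lemma left_deriv_add: "left_deriv x (p + q) = left_deriv x p + left_deriv x q"
  by (rule poly_mapping_eqI) (simp add: lookup_left_deriv lookup_add)

lemma left_deriv_diff: "left_deriv x (p - q) = left_deriv x p - left_deriv x q"
  by (rule poly_mapping_eqI) (simp add: lookup_left_deriv lookup_minus)

lemma left_deriv_zero [simp]: "left_deriv x 0 = 0"
  by (rule poly_mapping_eqI) (simp add: lookup_left_deriv)

lemma left_deriv_one [simp]: "left_deriv x 1 = 0"
  by (rule poly_mapping_eqI)
    (auto simp: lookup_left_deriv lookup_one when_def zero_word_def plus_word_def)

lemma left_deriv_letter:
  "left_deriv x (Poly_Mapping.single (Word [y]) 1 * p) = (if x = y then p else 0)"
proof (induction p rule: poly_mapping_add_induct)
  case (single w k)
  show ?case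
    by (rule poly_mapping_eqI)
      (auto simp: lookup_left_deriv mult_single lookup_single when_def plus_word_def word.expand)
qed (simp add: algebra_simps left_deriv_add)

lemma left_deriv_pa_pb [simp]:
  "left_deriv A (pa * p) = p" "left_deriv B (pa * p) = 0"
  "left_deriv A (pb * p) = 0" "left_deriv B (pb * p) = p"
  by (simp_all add: pa_def pb_def left_deriv_letter)

text \<open>If \<open>p = k + c q + d r\<close>, then \<open>cd_strip D p = r\<close> and \<open>cd_strip C p = q\<close>.\<close>

fun cd_strip :: "cd \<Rightarrow> ab_poly \<Rightarrow> ab_poly" where
  "cd_strip D p = left_deriv A (left_deriv B p - left_deriv A p)"
| "cd_strip C p = left_deriv A p - pb * left_deriv A (left_deriv B p - left_deriv A p)"

fun cd_coeff :: "cd list \<Rightarrow> ab_poly \<Rightarrow> int" where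
  "cd_coeff [] p = Poly_Mapping.lookup p 0"
| "cd_coeff (x # w) p = cd_coeff w (cd_strip x p)"

lemma cd_strip_add: "cd_strip x (p + q) = cd_strip x p + cd_strip x q"
  by (cases x) (simp_all add: left_deriv_add left_deriv_diff algebra_simps)

lemma cd_coeff_add: "cd_coeff w (p + q) = cd_coeff w p + cd_coeff w q"
  by (induction w arbitrary: p q) (simp_all add: lookup_add cd_strip_add)

lemma cd_coeff_zero [simp]: "cd_coeff w 0 = 0"
  using cd_coeff_add[of w 0 0] by simp

lemma cd_coeff_of_int: "cd_coeff w (of_int k * p) = k * cd_coeff w p"
proof -
  have nat: "cd_coeff w (of_nat n * p) = int n * cd_coeff w p" for n
    by (induction n) (simp_all add: cd_coeff_add algebra_simps)
  have "cd_coeff w (- q) = - cd_coeff w q" for q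
    using cd_coeff_add[of w q "- q"] by simp
  then show ?thesis
    by (cases k rule: int_cases2) (simp_all add: nat)
qed

lemma cd_strip_one [simp]: "cd_strip x 1 = 0"
  by (cases x) (simp_all add: left_deriv_diff)

text \<open>The cofactors of c q + d r are q + b r at the letter a and q + a r at the letter b.
  Their difference (a - b) r has r as its cofactor at a, and subtracting b r from the first cofactor
  gives q.\<close>

lemma cd_strip_letter: "cd_strip x (cd_letter y * p) = (if x = y then p else 0)"
  by (cases x; cases y)
    (simp_all add: left_deriv_add left_deriv_diff algebra_simps mult.assoc)

lemma lookup_letter_mult_zero: "Poly_Mapping.lookup (cd_letter x * p) 0 = 0"
proof -
  have *: "Poly_Mapping.lookup (Poly_Mapping.single (Word [y]) 1 * p) 0 = 0" for y and p :: ab_poly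
    by (induction p rule: poly_mapping_add_induct)
      (auto simp: mult_single lookup_single plus_word_def zero_word_def when_def lookup_add algebra_simps)
  show ?thesis
    by (cases x) (simp_all add: pa_def pb_def algebra_simps lookup_add * mult.assoc)
qed

lemma cd_coeff_monom: "cd_coeff u (cd_monom (Word v)) = (if u = v then 1 else 0)"
proof (induction u arbitrary: v)
  case Nil
  then show ?case
    by (cases v) (simp_all add: cd_monom_def lookup_one lookup_letter_mult_zero)
next
  case (Cons x u)
  show ?case
  proof (cases v)
    case Nil
    then show ?thesis by (simp add: cd_monom_def)
  next
    case v: (Cons y v')
    have "cd_monom (Word v) = cd_letter y * cd_monom (Word v')"
      by (simp add: v cd_monom_def)
    then have "cd_coeff (x # u) (cd_monom (Word v)) = cd_coeff u (if x = y then cd_monom (Word v') else 0)"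
      by (simp add: cd_strip_letter)
    then show ?thesis
      using Cons.IH[of v'] by (cases "x = y") (simp_all add: v del: cd_coeff.simps(2))
  qed
qed

text \<open>The additive functionals \<open>cd_coeff w\<close> are dual to the cd-monomials. They
  give the injectivity of the substitution, and, being integer-valued on all ab-polynomials, later
  the divisibility by 2.\<close>

lemma cd_coeff_subst: "cd_coeff w (cd_subst q) = Poly_Mapping.lookup q (Word w)"
proof (induction q rule: poly_mapping_add_induct)
  case (single v k)
  then show ?case
    by (cases v) (simp add: cd_subst_single cd_coeff_of_int cd_coeff_monom lookup_single when_def)
qed (simp add: cd_subst_add cd_coeff_add lookup_add)

lemma inj_cd_subst: "inj cd_subst"
proof (rule injI)
  fix p q assume "cd_subst p = cd_subst q"
  then have "Poly_Mapping.lookup p (Word w) = Poly_Mapping.lookup q (Word w)" for w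
    by (metis cd_coeff_subst)
  then show "p = q"
    by (metis poly_mapping_eqI word.collapse)
qed

lemma to_cd_subst [simp]: "to_cd (cd_subst q) = q"
  unfolding to_cd_def by (rule the_equality) (auto dest: injD[OF inj_cd_subst])

section \<open>The subring of ab-polynomials expressible in c and d\<close>

abbreviation CD :: "ab_poly set" where "CD \<equiv> range cd_subst"

lemma cd_subst_to_cd: "p \<in> CD \<Longrightarrow> cd_subst (to_cd p) = p"
  by auto

lemma CD_add: "p \<in> CD \<Longrightarrow> q \<in> CD \<Longrightarrow> p + q \<in> CD"
  by (auto simp flip: cd_subst_add)

lemma CD_mult: "p \<in> CD \<Longrightarrow> q \<in> CD \<Longrightarrow> p * q \<in> CD"
  by (auto simp flip: cd_subst_mult)

lemma CD_uminus: "p \<in> CD \<Longrightarrow> - p \<in> CD"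
  by (auto simp flip: cd_subst_uminus)

lemma CD_diff: "p \<in> CD \<Longrightarrow> q \<in> CD \<Longrightarrow> p - q \<in> CD"
  using CD_add[of p "- q"] CD_uminus by simp

lemma CD_zero: "0 \<in> CD"
  using rangeI[of cd_subst 0] by simp

lemma CD_sum: "(\<And>i. i \<in> S \<Longrightarrow> f i \<in> CD) \<Longrightarrow> (\<Sum>i\<in>S. f i) \<in> CD"
  by (induction S rule: infinite_finite_induct) (simp_all add: CD_zero CD_add)

lemma cd_monom_in_CD: "cd_monom w \<in> CD"
  using rangeI[of cd_subst "Poly_Mapping.single w 1"] by (simp add: cd_subst_single)

lemma CD_one: "1 \<in> CD"
  using cd_monom_in_CD[of "Word []"] by (simp add: cd_monom_def)

lemma CD_power: "p \<in> CD \<Longrightarrow> p ^ k \<in> CD"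
  by (induction k) (simp_all add: CD_one CD_mult)

lemma CD_c: "pa + pb \<in> CD"
  using cd_monom_in_CD[of "Word [C]"] by (simp add: cd_monom_def)

lemma CD_d: "pa * pb + pb * pa \<in> CD"
  using cd_monom_in_CD[of "Word [D]"] by (simp add: cd_monom_def)

text \<open>(a - b)^2 = c^2 - 2d. An odd power changes sign when a and b are exchanged, whereas
  every polynomial in c and d is fixed by that exchange; hence the parity condition.\<close>

lemma CD_even_power:
  assumes "even k"
  shows "(pa - pb) ^ k \<in> CD"
proof -
  have "(pa - pb) ^ 2 =
      (pa + pb) * (pa + pb) - ((pa * pb + pb * pa) + (pa * pb + pb * pa))"
    by (simp add: power2_eq_square algebra_simps)
  also have "\<dots> \<in> CD"
    by (intro CD_add CD_diff CD_mult CD_c CD_d)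
  finally have "((pa - pb) ^ 2) ^ (k div 2) \<in> CD"
    by (rule CD_power)
  then show ?thesis
    using assms by (simp flip: power_mult)
qed

text \<open>The functionals \<open>cd_coeff w\<close> are additive and integer-valued at p itself,
  before p is known to lie in the image, so all cd-coefficients of p + p are even. Halving them
  gives a preimage of p, since integer coefficients have no 2-torsion.\<close>

lemma CD_half:
  assumes "p + p \<in> CD"
  shows "p \<in> CD"
proof -
  obtain q where q: "cd_subst q = p + p"
    using assms by auto
  define h where "h = Poly_Mapping.map (\<lambda>k. k div 2) q"
  have "even (Poly_Mapping.lookup q (Word w))" for w
    by (simp add: q cd_coeff_add flip: cd_coeff_subst)
  then have even: "even (Poly_Mapping.lookup q v)" for v
    by (metis word.collapse)
  have "h + h = q"
  proof (rule poly_mapping_eqI)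
    show "Poly_Mapping.lookup (h + h) v = Poly_Mapping.lookup q v" for v
      using even[of v] unfolding h_def lookup_add by (auto simp: Poly_Mapping.map.rep_eq when_def)
  qed
  then have "cd_subst h + cd_subst h = p + p"
    using q cd_subst_add by metis
  then have "Poly_Mapping.lookup (cd_subst h + cd_subst h) v = Poly_Mapping.lookup (p + p) v" for v
    by (rule arg_cong)
  then have "Poly_Mapping.lookup (cd_subst h) v = Poly_Mapping.lookup p v" for v
    unfolding lookup_add by (smt (verit))
  then have "cd_subst h = p"
    by (rule poly_mapping_eqI)
  then show ?thesis by blast
qed

section \<open>Alternating sums of powers of a - b and the symmetrised recursion\<close>

lemma neg_one_power_mult_power:
  fixes e :: "'r::ring_1"
  shows "(- e) ^ i * e ^ j = (-1) ^ i * e ^ (i + j)"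
  by (metis mult.assoc power_add power_minus)

text \<open>The exponents r z - k and l - r z add up to a constant, so only the sign depends on z
  and an integer alternating sum factors out. This is how the Eulerian relations enter the
  polynomial identities.\<close>

lemma neg_power_sum:
  fixes e :: "'r::ring_1"
  assumes "\<And>z. z \<in> S \<Longrightarrow> k \<le> r z \<and> r z \<le> l"
  shows "(\<Sum>z\<in>S. (- e) ^ (r z - k) * e ^ (l - r z)) = of_int ((-1) ^ k * (\<Sum>z\<in>S. (-1) ^ r z)) * e ^ (l - k)"
proof -
  have "(- e) ^ (r z - k) * e ^ (l - r z) = of_int ((-1) ^ k * (-1) ^ r z) * e ^ (l - k)"
    if "z \<in> S" for z
  proof -
    have "(-1::int) ^ (r z - k) = (-1) ^ k * (-1) ^ r z"
      using assms[OF that] by (simp add: minus_one_power_iff)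
    then have "(-1::'r) ^ (r z - k) = of_int ((-1) ^ k * (-1) ^ r z)"
      by (metis of_int_1 of_int_minus of_int_power)
    then show ?thesis
      using assms[OF that] by (simp add: neg_one_power_mult_power)
  qed
  then show ?thesis
    by (simp add: sum_distrib_left sum_distrib_right)
qed

text \<open>Inverting the zeta-like matrix \<open>(a-b)^\<rho>(x,y)\<close> of an Eulerian poset turns the recursion for
  \<open>F\<close> into its image under exchanging \<open>a\<close> and \<open>b\<close>. Averaging the two recursions leaves
  only coefficients in \<open>c\<close> and \<open>d\<close>.\<close>

lemma eulerian_recursion_in_CD:
  fixes P :: "'a::order set" and r :: "'a \<Rightarrow> nat" and F T :: "'a \<Rightarrow> ab_poly"
  assumes fin: "finite P"
    and mono: "\<And>x y. x \<in> P \<Longrightarrow> y \<in> P \<Longrightarrow> x < y \<Longrightarrow> r x < r y"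
    and rec: "\<And>x. x \<in> P \<Longrightarrow>
      F x = T x + (\<Sum>z\<in>{z \<in> P. x < z}. (pa - pb) ^ (r z - r x - 1) * pb * F z)"
    and eul: "\<And>x y. x \<in> P \<Longrightarrow> y \<in> P \<Longrightarrow> x < y \<Longrightarrow>
      (\<Sum>z\<in>{z \<in> P. x \<le> z \<and> z \<le> y}. (-1::int) ^ r z) = 0"
    and T: "\<And>x. x \<in> P \<Longrightarrow>
      T x + (\<Sum>z\<in>{z \<in> P. x \<le> z}. (- (pa - pb)) ^ (r z - r x) * T z) \<in> CD"
    and "x \<in> P"
  shows "F x \<in> CD"
  using \<open>x \<in> P\<close>
proof (induction "card {z \<in> P. x < z}" arbitrary: x rule: less_induct)
  case less
  define e where "e = pa - pb"
  let ?U = "{z \<in> P. x < z}" and ?V = "{z \<in> P. x \<le> z}"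
  have V: "?V = insert x ?U" and xU: "x \<notin> ?U"
    using less.prems by auto
  have IH: "F y \<in> CD" if "y \<in> ?U" for y
  proof (rule less.hyps)
    show "card {z \<in> P. y < z} < card ?U"
      by (rule psubset_card_mono) (use that fin in auto)
  qed (use that in auto)
  have inner: "(\<Sum>z\<in>{z \<in> P. x \<le> z \<and> z < y}. (- e) ^ (r z - r x) * e ^ (r y - r z - 1))
      = (- e) ^ (r y - r x - 1)" if "y \<in> ?U" for y
  proof -
    let ?I = "{z \<in> P. x \<le> z \<and> z < y}"
    have le: "r x \<le> r z" "r z < r y" if "z \<in> ?I" for z
      using that less.prems \<open>y \<in> ?U\<close> mono[of x z] mono[of z y] by (auto simp: order_le_less)
    have "{z \<in> P. x \<le> z \<and> z \<le> y} = insert y ?I" "y \<notin> ?I"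
      using \<open>y \<in> ?U\<close> by auto
    \<comment> \<open>The Eulerian relation for the closed interval turns the sum over the half-open
      one into minus the missing top term.\<close>
    then have s: "(\<Sum>z\<in>?I. (-1::int) ^ r z) = - ((-1) ^ r y)"
      using eul[of x y] fin \<open>y \<in> ?U\<close> less.prems by simp
    have xy: "r x < r y"
      using mono[of x y] less.prems \<open>y \<in> ?U\<close> by auto
    have "(\<Sum>z\<in>?I. (- e) ^ (r z - r x) * e ^ (r y - r z - 1)) =
      (\<Sum>z\<in>?I. (- e) ^ (r z - r x) * e ^ ((r y - 1) - r z))"
      by (simp add: diff_commute)
    also have "\<dots> = of_int ((-1) ^ r x * - ((-1) ^ r y)) * e ^ (r y - 1 - r x)"
      unfolding s[symmetric] using le by (intro neg_power_sum) force
    also have "(-1) ^ r x * - ((-1::int) ^ r y) = (-1) ^ (r y - 1 - r x)"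
      using xy by (auto simp: minus_one_power_iff)
    also have "of_int ((-1) ^ (r y - 1 - r x)) * e ^ (r y - 1 - r x) = (- e) ^ (r y - r x - 1)"
      by (metis diff_commute of_int_1 of_int_minus of_int_power power_minus)
    finally show ?thesis .
  qed
  define T' where "T' = (\<Sum>z\<in>?V. (- e) ^ (r z - r x) * T z)"
  \<comment> \<open>The recursions for all z above or equal to x are added with the weights of the
    inverse matrix. After the order of summation is exchanged, the inner sum is the one evaluated in
    \<open>inner\<close>.\<close>
  have "(\<Sum>z\<in>?V. (- e) ^ (r z - r x) * F z) =
      (\<Sum>z\<in>?V. (- e) ^ (r z - r x) * T z +
        (\<Sum>y\<in>{y \<in> P. z < y}. (- e) ^ (r z - r x) * e ^ (r y - r z - 1) * pb * F y))"
    by (intro sum.cong refl) (subst rec, auto simp: e_def distrib_left sum_distrib_left mult.assoc)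
  also have "\<dots> = T' +
      (\<Sum>z\<in>?V. \<Sum>y\<in>{y \<in> ?U. z < y}. (- e) ^ (r z - r x) * e ^ (r y - r z - 1) * pb * F y)"
    unfolding sum.distrib T'_def by (intro arg_cong2[of _ _ _ _ "(+)"] sum.cong refl) auto
  also have "(\<Sum>z\<in>?V. \<Sum>y\<in>{y \<in> ?U. z < y}. (- e) ^ (r z - r x) * e ^ (r y - r z - 1) * pb * F y)
     = (\<Sum>y\<in>?U. \<Sum>z\<in>{z \<in> ?V. z < y}. (- e) ^ (r z - r x) * e ^ (r y - r z - 1) * pb * F y)"
    using fin by (intro sum.swap_restrict) auto
  also have "\<dots> = (\<Sum>y\<in>?U. (- e) ^ (r y - r x - 1) * pb * F y)"
  proof (intro sum.cong refl)
    fix y assume "y \<in> ?U"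
    have "{z \<in> ?V. z < y} = {z \<in> P. x \<le> z \<and> z < y}" by auto
    then show "(\<Sum>z\<in>{z \<in> ?V. z < y}. (- e) ^ (r z - r x) * e ^ (r y - r z - 1) * pb * F y)
        = (- e) ^ (r y - r x - 1) * pb * F y"
      by (simp only: inner[OF \<open>y \<in> ?U\<close>] flip: sum_distrib_right)
  qed
  also have "(\<Sum>z\<in>?V. (- e) ^ (r z - r x) * F z) = F x + (\<Sum>y\<in>?U. (- e) ^ (r y - r x) * F y)"
    unfolding V using fin xU by (subst sum.insert) auto
  finally have "F x = T' + (\<Sum>y\<in>?U. (- e) ^ (r y - r x - 1) * pb * F y)
      - (\<Sum>y\<in>?U. (- e) ^ (r y - r x) * F y)"
    by (simp add: algebra_simps)
  also have "\<dots> = T' + (\<Sum>y\<in>?U. (- e) ^ (r y - r x - 1) * pb * F y - (- e) ^ (r y - r x) * F y)"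
    by (simp add: sum_subtractf)
  \<comment> \<open>Since b + e = a, absorbing the terms brought over from the left side replaces b
    by a.\<close>
  also have "\<dots> = T' + (\<Sum>y\<in>?U. (- e) ^ (r y - r x - 1) * pa * F y)"
  proof (intro arg_cong2[of _ _ _ _ "(+)"] sum.cong refl)
    fix y assume "y \<in> ?U"
    then have "r y - r x = Suc (r y - r x - 1)"
      using mono[of x y] less.prems by auto
    then have *: "(- e) ^ (r y - r x) = (- e) ^ (r y - r x - 1) * (- e)"
      by (metis power_Suc2)
    show "(- e) ^ (r y - r x - 1) * pb * F y - (- e) ^ (r y - r x) * F y
        = (- e) ^ (r y - r x - 1) * pa * F y"
      unfolding * by (simp add: e_def algebra_simps)
  qed
  finally have swapped: "F x = T' + (\<Sum>y\<in>?U. (- e) ^ (r y - r x - 1) * pa * F y)" .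
  have "F x + F x = (T x + T') +
      (\<Sum>y\<in>?U. (e ^ (r y - r x - 1) * pb + (- e) ^ (r y - r x - 1) * pa) * F y)"
    by (subst (2) swapped, subst rec[OF less.prems])
      (simp add: e_def sum.distrib algebra_simps)
  also have "\<dots> \<in> CD"
  proof (rule CD_add[OF _ CD_sum[OF CD_mult[OF _ IH]]])
    show "T x + T' \<in> CD"
      using T[OF less.prems] by (simp add: T'_def e_def)
    fix y
    show "e ^ (r y - r x - 1) * pb + (- e) ^ (r y - r x - 1) * pa \<in> CD" (is "?c \<in> _")
    \<comment> \<open>With k the exponent, the coefficient is e^k c for even k and -e^(k+1) for odd
      k; in both cases only an even power of e remains.\<close>
    proof (cases "even (r y - r x - 1)")
      case True
      then have "?c = e ^ (r y - r x - 1) * (pa + pb)"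
        by (simp add: algebra_simps)
      with True show ?thesis
        by (simp add: e_def CD_mult CD_even_power CD_c)
    next
      case False
      then have "(- e) ^ (r y - r x - 1) = - (e ^ (r y - r x - 1))"
        by simp
      then have "?c = e ^ (r y - r x - 1) * (pb - pa)"
        by (simp add: algebra_simps)
      also have "\<dots> = - (e ^ (r y - r x - 1) * e)"
        by (simp add: e_def flip: mult_minus_right)
      also have "\<dots> = - (e ^ Suc (r y - r x - 1))"
        by (simp only: power_Suc2)
      also have "\<dots> \<in> CD"
        unfolding e_def using False by (intro CD_uminus CD_even_power) simp
      finally show ?thesis .
    qed
  qed
  finally show ?case by (rule CD_half)
qed

section \<open>Homology and the Euler characteristic\<close>

text \<open>A basis A of the kernel in S is extended to a basis B of S; f is injective on the span
  of B - A, whose image spans f(S). The finite set W replaces finite dimension of the ambient space,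
  which fails for functions on vertex lists.\<close>

lemma (in vector_space_pair) rank_nullity_subspace:
  assumes f: "Vector_Spaces.linear s1 s2 f" and S: "vs1.subspace S"
    and W: "finite W" "S \<subseteq> vs1.span W"
  shows "vs1.dim S = vs1.dim {x \<in> S. f x = 0} + vs2.dim (f ` S)"
proof -
  interpret f: Vector_Spaces.linear s1 s2 f by (rule f)
  let ?K = "{x \<in> S. f x = 0}"
  obtain A where A: "A \<subseteq> ?K" "vs1.independent A" "?K \<subseteq> vs1.span A"
    by (rule vs1.maximal_independent_subset)
  obtain B where B: "A \<subseteq> B" "B \<subseteq> S" "vs1.independent B" "S \<subseteq> vs1.span B"
    using vs1.maximal_independent_subset_extend[OF _ A(2), of S] A(1) by blast
  have finB: "finite B"
    using vs1.independent_span_bound[OF W(1) B(3)] B(2) W(2) by auto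
  let ?C = "B - A"
  have indC: "vs1.independent ?C"
    using B(3) vs1.independent_mono by blast
  have "x = 0" if x: "x \<in> vs1.span ?C" "f x = 0" for x
  proof -
    have "x \<in> S"
      using x(1) B(2) S vs1.span_minimal[of ?C S] by auto
    then have xA: "x \<in> vs1.span A"
      using x A(3) by auto
    \<comment> \<open>x lies both in the span of A and in the span of B - A. Its two representations
      agree inside B but have disjoint supports, so all coefficients vanish.\<close>
    have "vs1.representation B x = vs1.representation A x"
      by (rule vs1.representation_extend) (use B xA in auto)
    moreover have "vs1.representation B x = vs1.representation ?C x"
      by (rule vs1.representation_extend) (use B x in auto)
    ultimately have "vs1.representation A x v = 0" for v
      using vs1.representation_ne_zero[of A x v] vs1.representation_ne_zero[of ?C x v] by auto
    then show ?thesis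
      using vs1.sum_nonzero_representation_eq[OF A(2) xA] by simp
  qed
  then have inj: "inj_on f (vs1.span ?C)"
    by (subst f.inj_on_iff_eq_0) auto
  have "vs2.independent (f ` ?C)"
    by (rule f.independent_injective_image[OF indC inj])
  moreover have "f ` S \<subseteq> vs2.span (f ` ?C)"
  proof -
    have "f ` S \<subseteq> vs2.span (f ` B)"
      using B(4) f.span_image[of B] by auto
    also have "f ` B \<subseteq> insert 0 (f ` ?C)"
      using A(1) by auto
    then have "vs2.span (f ` B) \<subseteq> vs2.span (f ` ?C)"
      using vs2.span_mono vs2.span_insert_0 by blast
    finally show ?thesis .
  qed
  moreover have "f ` ?C \<subseteq> f ` S"
    using B(2) by auto
  ultimately have "vs2.dim (f ` S) = card (f ` ?C)"
    by (simp add: vs2.basis_card_eq_dim)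
  also have "\<dots> = card ?C"
    using inj_on_subset[OF inj vs1.span_superset] by (rule card_image)
  finally have "vs2.dim (f ` S) = card ?C" .
  moreover have "card B = vs1.dim S" "card A = vs1.dim ?K"
    using A B by (simp_all add: vs1.basis_card_eq_dim)
  moreover have "card B = card A + card ?C"
    using finB B(1) by (metis card_Diff_subset card_mono finite_subset le_add_diff_inverse)
  ultimately show ?thesis by simp
qed

section \<open>Chains, cycles and boundaries as real vector spaces\<close>

definition fscale :: "real \<Rightarrow> ('x \<Rightarrow> real) \<Rightarrow> 'x \<Rightarrow> real" where
  "fscale k f = (\<lambda>x. k * f x)"

interpretation fs: vector_space fscale
  by standard (auto simp: fscale_def fun_eq_iff algebra_simps)

interpretation fsp: vector_space_pair fscale fscale ..

lemma sum_fun_apply: "(\<Sum>i\<in>S. f i) x = (\<Sum>i\<in>S. f i x :: real)"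
  by (induction S rule: infinite_finite_induct) auto

lemma chains_support:
  "c \<in> chains \<Delta> i \<Longrightarrow> c xs \<noteq> 0 \<Longrightarrow> int (length xs) = i + 1 \<and> set xs \<in> \<Delta>"
  unfolding chains_def by blast

lemma chains_alternating:
  "c \<in> chains \<Delta> i \<Longrightarrow> c (xs @ u # v # ys) = - c (xs @ v # u # ys)"
  unfolding chains_def by blast

lemma chainsI:
  assumes "\<And>xs. c xs \<noteq> 0 \<Longrightarrow> int (length xs) = i + 1 \<and> set xs \<in> \<Delta>"
    and "\<And>xs u v ys. c (xs @ u # v # ys) = - c (xs @ v # u # ys)"
  shows "c \<in> chains \<Delta> i"
  using assms unfolding chains_def by blast

lemma subspace_chains: "fs.subspace (chains \<Delta> i)"
proof (rule fs.subspaceI)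
  show "0 \<in> chains \<Delta> i"
    by (rule chainsI) simp_all
next
  fix c d assume cd: "c \<in> chains \<Delta> i" "d \<in> chains \<Delta> i"
  show "c + d \<in> chains \<Delta> i"
  proof (rule chainsI)
    show "int (length xs) = i + 1 \<and> set xs \<in> \<Delta>" if "(c + d) xs \<noteq> 0" for xs
      using that chains_support[OF cd(1), of xs] chains_support[OF cd(2), of xs] by fastforce
    show "(c + d) (xs @ u # v # ys) = - (c + d) (xs @ v # u # ys)" for xs u v ys
      using chains_alternating[OF cd(1), of xs u v ys] chains_alternating[OF cd(2), of xs u v ys]
      by simp
  qed
next
  fix k c assume c: "c \<in> chains \<Delta> i"
  show "fscale k c \<in> chains \<Delta> i"
  proof (rule chainsI)
    show "int (length xs) = i + 1 \<and> set xs \<in> \<Delta>" if "fscale k c xs \<noteq> 0" for xs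
      using that chains_support[OF c, of xs] by (simp add: fscale_def)
    show "fscale k c (xs @ u # v # ys) = - fscale k c (xs @ v # u # ys)" for xs u v ys
      using chains_alternating[OF c, of xs u v ys] by (simp add: fscale_def)
  qed
qed

lemma boundary_linear: "Vector_Spaces.linear fscale fscale (boundary \<Delta>)"
  by unfold_locales
    (auto simp: boundary_def fscale_def fun_eq_iff sum.distrib sum_distrib_left)

lemma boundary_chains:
  assumes "abs_complex \<Delta>" "c \<in> chains \<Delta> (i + 1)"
  shows "boundary \<Delta> c \<in> chains \<Delta> i"
proof (rule chainsI)
  fix xs assume "boundary \<Delta> c xs \<noteq> 0"
  then obtain v where "c (v # xs) \<noteq> 0"
    unfolding boundary_def by (meson sum.not_neutral_contains_not_neutral)
  then have "int (length (v # xs)) = i + 1 + 1" "set (v # xs) \<in> \<Delta>"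
    using chains_support[OF assms(2)] by blast+
  moreover have "set xs \<subseteq> set (v # xs)"
    by auto
  moreover have "y \<in> \<Delta>" if "x \<in> \<Delta>" "y \<subseteq> x" for x y
    using that assms(1) unfolding abs_complex_def by blast
  ultimately show "int (length xs) = i + 1 \<and> set xs \<in> \<Delta>"
    by fastforce
next
  fix xs u v ys
  have "c ((w # xs) @ u # v # ys) = - c ((w # xs) @ v # u # ys)" for w
    by (rule chains_alternating[OF assms(2)])
  then show "boundary \<Delta> c (xs @ u # v # ys) = - boundary \<Delta> c (xs @ v # u # ys)"
    by (simp add: boundary_def sum_negf)
qed

lemma boundary_boundary:
  assumes "c \<in> chains \<Delta> i"
  shows "boundary \<Delta> (boundary \<Delta> c) = (\<lambda>_. 0)"
proof
  fix xs
  have alt: "c (u # v # xs) = - c (v # u # xs)" for u v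
    using chains_alternating[OF assms, of "[]" u v xs] by simp
  have "boundary \<Delta> (boundary \<Delta> c) xs = (\<Sum>u\<in>\<Union>\<Delta>. \<Sum>v\<in>\<Union>\<Delta>. c (v # u # xs))"
    by (simp add: boundary_def)
  also have "\<dots> = (\<Sum>v\<in>\<Union>\<Delta>. \<Sum>u\<in>\<Union>\<Delta>. c (v # u # xs))"
    by (rule sum.swap)
  \<comment> \<open>Exchanging the summations and then the first two entries shows that the double
    boundary equals its own negative.\<close>
  also have "\<dots> = (\<Sum>v\<in>\<Union>\<Delta>. \<Sum>u\<in>\<Union>\<Delta>. - c (u # v # xs))"
    by (intro sum.cong refl alt)
  also have "\<dots> = - boundary \<Delta> (boundary \<Delta> c) xs"
    by (simp add: boundary_def sum_negf)
  finally show "boundary \<Delta> (boundary \<Delta> c) xs = 0" by simp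
qed

lemma boundaries_subset_cycles:
  assumes "abs_complex \<Delta>"
  shows "boundaries \<Delta> i \<subseteq> cycles \<Delta> i"
  using assms boundary_chains boundary_boundary unfolding boundaries_def cycles_def by fast

lemma subspace_cycles: "fs.subspace (cycles \<Delta> i)"
proof -
  have "cycles \<Delta> i = chains \<Delta> i \<inter> {c. boundary \<Delta> c = 0}"
    by (auto simp: cycles_def zero_fun_def)
  then show ?thesis
    by (simp add: fs.subspace_inter subspace_chains fsp.linear_subspace_kernel boundary_linear)
qed

lemma subspace_boundaries: "fs.subspace (boundaries \<Delta> i)"
  unfolding boundaries_def
  by (rule fsp.linear_subspace_image[OF boundary_linear subspace_chains])

subsection \<open>The dimension of the chain spaces\<close>

text \<open>Adjacent transpositions generate all permutations. The common prefix \<open>ps\<close>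
  is generalised so that, once the first entry is in place, the induction can continue behind
  it.\<close>

lemma swap_invariant_perm:
  assumes swap: "\<And>xs u v ys. h (xs @ u # v # ys) = h (xs @ v # u # ys)"
    and "mset xs = mset ys"
  shows "h xs = h ys"
proof -
  have move: "h (ps @ us @ x # vs) = h (ps @ x # us @ vs)" for ps us x vs
  proof (induction us arbitrary: ps)
    case (Cons u us)
    show ?case
      using Cons[of "ps @ [u]"] swap[of ps u x "us @ vs"] by simp
  qed simp
  have "h (ps @ xs) = h (ps @ ys)" if "mset xs = mset ys" for ps
    using that
  proof (induction xs arbitrary: ps ys)
    case (Cons x xs)
    then obtain us vs where ys: "ys = us @ x # vs"
      by (metis list.set_intros(1) mset_eq_setD split_list)
    then have "mset xs = mset (us @ vs)"
      using Cons.prems by simp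
    then have "h ((ps @ [x]) @ xs) = h ((ps @ [x]) @ us @ vs)"
      by (rule Cons.IH)
    then show ?case
      using move by (simp add: ys)
  qed simp
  from this[of "[]"] assms(2) show ?thesis by simp
qed

text \<open>The inversion sign; it vanishes on lists with repeated indices, so that alternation holds
  without side conditions.\<close>

fun osign :: "('v \<Rightarrow> nat) \<Rightarrow> 'v list \<Rightarrow> real" where
  "osign g [] = 1"
| "osign g (v # xs) = prod_list (map (\<lambda>u. sgn (real (g u) - real (g v))) xs) * osign g xs"

lemma osign_swap: "osign g (xs @ u # v # ys) = - osign g (xs @ v # u # ys)"
proof (induction xs)
  case Nil
  show ?case by (simp add: sgn_if mult_ac)
qed (simp add: mult_ac)

lemma osign_square:
  assumes "distinct (map g xs)"
  shows "osign g xs * osign g xs = 1"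
  using assms
proof (induction xs)
  case (Cons v xs)
  have "prod_list (map (\<lambda>u. sgn (real (g u) - real (g v))) ys)
      * prod_list (map (\<lambda>u. sgn (real (g u) - real (g v))) ys) = 1"
    if "g v \<notin> g ` set ys" for ys
    using that by (induction ys) (auto simp: sgn_if mult_ac)
  from this[of xs] Cons show ?case
    by (simp add: mult_ac)
qed simp

text \<open>The elementary chain of the face x, oriented by the numbering g of the vertices. For
  finite x the length condition leaves exactly the orderings of x without repetition.\<close>

definition face_chain :: "('v \<Rightarrow> nat) \<Rightarrow> 'v set \<Rightarrow> 'v list \<Rightarrow> real" where
  "face_chain g x xs = (if set xs = x \<and> length xs = card x then osign g xs else 0)"

text \<open>The product of two alternating functions is symmetric.\<close>

lemma chains_alternating_perm:
  assumes "c \<in> chains \<Delta> i" "mset xs = mset ys"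
  shows "c xs * osign g xs = c ys * osign g ys"
proof (rule swap_invariant_perm[OF _ assms(2)])
  fix xs u v ys
  have "c (xs @ u # v # ys) = - c (xs @ v # u # ys)"
    by (rule chains_alternating[OF assms(1)])
  then show "c (xs @ u # v # ys) * osign g (xs @ u # v # ys)
      = c (xs @ v # u # ys) * osign g (xs @ v # u # ys)"
    by (simp add: osign_swap[of g xs u v])
qed

text \<open>The absolute value of an alternating function is symmetric, so two equal entries may be
  moved to the front, where swapping them gives c = -c.\<close>

lemma chains_distinct:
  assumes c: "c \<in> chains \<Delta> i" and "c xs \<noteq> 0"
  shows "distinct xs"
proof (rule ccontr)
  assume "\<not> distinct xs"
  then obtain as bs cs y where xs: "xs = as @ [y] @ bs @ [y] @ cs"
    using not_distinct_decomp by blast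
  have alt: "c (xs @ u # v # ys) = - c (xs @ v # u # ys)" for xs u v ys
    by (rule chains_alternating[OF c])
  have "\<bar>c xs\<bar> = \<bar>c (y # y # as @ bs @ cs)\<bar>"
  proof (rule swap_invariant_perm)
    show "\<bar>c (xs @ u # v # ys)\<bar> = \<bar>c (xs @ v # u # ys)\<bar>" for xs u v ys
      using alt[of xs u v ys] by simp
  qed (simp add: xs)
  also have "c (y # y # as @ bs @ cs) = 0"
    using alt[of "[]" y y] by simp
  finally show False using assms(2) by simp
qed

text \<open>The elementary chains of the faces with k vertices form a basis. Counting vertices
  instead of dimension makes k = 0 the augmentation degree.\<close>

lemma chains_basis:
  fixes \<Delta> :: "'v set set"
  assumes \<Delta>: "abs_complex \<Delta>"
  shows "\<exists>W. finite W \<and> chains \<Delta> (int k - 1) \<subseteq> fs.span W"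
    and "fs.dim (chains \<Delta> (int k - 1)) = card {x \<in> \<Delta>. card x = k}"
proof -
  have fin: "finite (\<Union>\<Delta>)"
    using \<Delta> unfolding abs_complex_def by blast
  then obtain g :: "'v \<Rightarrow> nat" where g: "inj_on g (\<Union>\<Delta>)"
    using finite_imp_inj_to_nat_seg by metis
  let ?X = "{x \<in> \<Delta>. card x = k}" and ?\<delta> = "face_chain g"
  have X: "finite x" if "x \<in> ?X" for x
    using that \<Delta> unfolding abs_complex_def by blast
  have finX: "finite ?X"
    using \<Delta> unfolding abs_complex_def by simp
  define l where "l x = (SOME xs. set xs = x \<and> distinct xs)" for x :: "'v set"
  have l: "set (l x) = x" "distinct (l x)" if "x \<in> ?X" for x
    using someI_ex[OF finite_distinct_list[OF X[OF that]]] unfolding l_def by auto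
  have sq: "osign g xs * osign g xs = 1" if "distinct xs" "set xs \<in> \<Delta>" for xs
    using that g by (intro osign_square) (auto simp: distinct_map intro: inj_on_subset)
  \<comment> \<open>Evaluation at one chosen ordering of each face is diagonal on the elementary
    chains, with nonzero entries; injectivity and independence follow from this.\<close>
  have \<delta>l: "?\<delta> x (l y) = (if x = y then osign g (l y) else 0)" if "x \<in> ?X" "y \<in> ?X" for x y
    using that l distinct_card[of "l y"] by (auto simp: face_chain_def)
  have nz: "osign g (l x) \<noteq> 0" if "x \<in> ?X" for x
    using sq[of "l x"] l that by auto
  have inj: "inj_on ?\<delta> ?X"
  proof (rule inj_onI)
    fix x y assume xy: "x \<in> ?X" "y \<in> ?X" "?\<delta> x = ?\<delta> y"
    then show "x = y"
      using \<delta>l[of x y] \<delta>l[of y y] nz[of y] by (auto split: if_splits)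
  qed
  have sub: "?\<delta> ` ?X \<subseteq> chains \<Delta> (int k - 1)"
  proof (safe, rule chainsI)
    fix x xs u v ys
    show "?\<delta> x (xs @ u # v # ys) = - ?\<delta> x (xs @ v # u # ys)"
      by (auto simp: face_chain_def osign_swap[of g xs u v] insert_commute)
  qed (auto simp: face_chain_def split: if_splits)
  have ind: "fs.independent (?\<delta> ` ?X)"
  proof (rule fs.independent_if_scalars_zero)
    fix f d assume sum0: "(\<Sum>d\<in>?\<delta> ` ?X. fscale (f d) d) = 0" and "d \<in> ?\<delta> ` ?X"
    then obtain y where y: "y \<in> ?X" "d = ?\<delta> y" by blast
    have "0 = (\<Sum>x\<in>?X. fscale (f (?\<delta> x)) (?\<delta> x)) (l y)"
      using sum0 by (simp add: sum.reindex[OF inj])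
    also have "\<dots> = (\<Sum>x\<in>?X. if x = y then f (?\<delta> y) * osign g (l y) else 0)"
      unfolding sum_fun_apply using y by (intro sum.cong refl) (simp add: fscale_def \<delta>l)
    also have "\<dots> = f d * osign g (l y)"
      using y finX by simp
    finally show "f d = 0"
      using nz[OF y(1)] by simp
  qed (use finX in simp)
  have span: "chains \<Delta> (int k - 1) \<subseteq> fs.span (?\<delta> ` ?X)"
  proof
    fix c assume c: "c \<in> chains \<Delta> (int k - 1)"
    \<comment> \<open>A sign is its own inverse, so the coefficient of a face is the value of c at
      the chosen ordering times the sign of that ordering.\<close>
    have "c = (\<Sum>x\<in>?X. fscale (c (l x) * osign g (l x)) (?\<delta> x))"
    proof
      fix xs
      have supp: "length xs = k" "set xs \<in> \<Delta>" "distinct xs" if "c xs \<noteq> 0"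
        using chains_support[OF c that] chains_distinct[OF c that] by auto
      show "c xs = (\<Sum>x\<in>?X. fscale (c (l x) * osign g (l x)) (?\<delta> x)) xs"
      proof (cases "distinct xs \<and> set xs \<in> ?X")
        case True
        have "(\<Sum>x\<in>?X. fscale (c (l x) * osign g (l x)) (?\<delta> x)) xs
            = (\<Sum>x\<in>?X. if x = set xs then c (l x) * osign g (l x) * osign g xs else 0)"
          unfolding sum_fun_apply using True distinct_card[of xs]
          by (intro sum.cong refl) (auto simp: fscale_def face_chain_def)
        also have "\<dots> = c (l (set xs)) * osign g (l (set xs)) * osign g xs"
          using True finX by simp
        also have "c (l (set xs)) * osign g (l (set xs)) = c xs * osign g xs"
          using l[of "set xs"] True
          by (intro chains_alternating_perm[OF c]) (auto simp: set_eq_iff_mset_eq_distinct)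
        also have "\<dots> * osign g xs = c xs"
          using sq[of xs] True by (simp add: mult.assoc)
        finally show ?thesis by simp
      next
        case False
        then have "c xs = 0"
          using supp distinct_card by fastforce
        moreover have "?\<delta> x xs = 0" if "x \<in> ?X" for x
          using that False card_distinct[of xs] by (auto simp: face_chain_def)
        ultimately show ?thesis
          by (simp add: sum_fun_apply fscale_def)
      qed
    qed
    also have "\<dots> \<in> fs.span (?\<delta> ` ?X)"
      by (intro fs.span_sum fs.span_scale fs.span_base) auto
    finally show "c \<in> fs.span (?\<delta> ` ?X)" .
  qed
  show "\<exists>W. finite W \<and> chains \<Delta> (int k - 1) \<subseteq> fs.span W"
    using span finX by blast
  have "fs.dim (chains \<Delta> (int k - 1)) = card (?\<delta> ` ?X)"
    using fs.basis_card_eq_dim[OF sub span ind] by simp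
  then show "fs.dim (chains \<Delta> (int k - 1)) = card ?X"
    by (simp add: card_image[OF inj])
qed

subsection \<open>Euler characteristics from homology\<close>

text \<open>Rank and nullity of the boundary map on the chains supported on faces with k + 1
  vertices.\<close>

lemma dim_chains_Suc:
  assumes "abs_complex \<Delta>"
  shows "card {x \<in> \<Delta>. card x = Suc k}
    = fs.dim (cycles \<Delta> (int (Suc k) - 1)) + fs.dim (boundaries \<Delta> (int k - 1))"
proof -
  obtain W where "finite W" "chains \<Delta> (int (Suc k) - 1) \<subseteq> fs.span W"
    using chains_basis(1)[OF assms] by blast
  from fsp.rank_nullity_subspace[OF boundary_linear subspace_chains this]
  show ?thesis
    using chains_basis(2)[OF assms, of "Suc k"]
    by (simp add: cycles_def boundaries_def zero_fun_def)
qed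

text \<open>In degree -1 every chain is a cycle: it is supported on the empty list, while the
  boundary reads only nonempty lists.\<close>

lemma dim_chains_0:
  assumes "abs_complex \<Delta>"
  shows "card {x \<in> \<Delta>. card x = 0} = fs.dim (cycles \<Delta> (int 0 - 1))"
proof -
  have "boundary \<Delta> c = (\<lambda>_. 0)" if "c \<in> chains \<Delta> (- 1)" for c
  proof
    fix xs
    have "c (v # xs) = 0" for v
      using chains_support[OF that, of "v # xs"] by force
    then show "boundary \<Delta> c xs = 0" by (simp add: boundary_def)
  qed
  then have "cycles \<Delta> (- 1) = chains \<Delta> (- 1)"
    by (auto simp: cycles_def)
  then show ?thesis
    using chains_basis(2)[OF assms, of 0] by simp
qed

text \<open>The Euler-Poincare formula, with \<open>h k\<close> the reduced Betti number in degree k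
  - 1. Cutting the alternating sums off at m leaves one boundary term \<beta>(m), which vanishes at
  K because no face has K + 1 vertices.\<close>

lemma euler_char_betti:
  assumes \<Delta>: "abs_complex \<Delta>"
    and h: "\<And>k. fs.dim (cycles \<Delta> (int k - 1)) = fs.dim (boundaries \<Delta> (int k - 1)) + h k"
    and K: "\<And>x. x \<in> \<Delta> \<Longrightarrow> card x \<le> K"
  shows "(\<Sum>x\<in>\<Delta>. (-1::int) ^ card x) = (\<Sum>k\<le>K. (-1) ^ k * int (h k))"
proof -
  define N where "N k = card {x \<in> \<Delta>. card x = k}" for k
  define \<beta> where "\<beta> k = fs.dim (boundaries \<Delta> (int k - 1))" for k
  have "(\<Sum>k\<le>m. (-1) ^ k * int (N k)) = (\<Sum>k\<le>m. (-1) ^ k * int (h k)) + (-1) ^ m * int (\<beta> m)" for m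
  proof (induction m)
    case 0
    then show ?case
      using dim_chains_0[OF \<Delta>] h[of 0] by (simp add: N_def \<beta>_def)
  next
    case (Suc m)
    have "N (Suc m) = \<beta> (Suc m) + h (Suc m) + \<beta> m"
      using dim_chains_Suc[OF \<Delta>, of m] h[of "Suc m"] by (simp add: N_def \<beta>_def)
    with Suc show ?case by (simp add: algebra_simps)
  qed
  moreover have "\<beta> K = 0"
  proof -
    have "{x \<in> \<Delta>. card x = Suc K} = {}"
      using K by force
    then show ?thesis
      using dim_chains_Suc[OF \<Delta>, of K] by (simp only: \<beta>_def card.empty)
  qed
  moreover have "(\<Sum>x\<in>\<Delta>. (-1::int) ^ card x) = (\<Sum>k\<le>K. (-1) ^ k * int (N k))"
  proof -
    have "finite \<Delta>"
      using \<Delta> by (simp add: abs_complex_def)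
    then have "(\<Sum>x\<in>\<Delta>. (-1::int) ^ card x) = (\<Sum>k\<le>K. \<Sum>x\<in>{x \<in> \<Delta>. card x = k}. (-1) ^ card x)"
      using K by (intro sum.group[symmetric]) auto
    then show ?thesis
      by (simp add: N_def mult.commute)
  qed
  ultimately show ?thesis by simp
qed

lemma boundaries_zero: "(\<lambda>_. 0) \<in> boundaries \<Delta> i"
  using fs.subspace_0[OF subspace_boundaries] by (simp add: zero_fun_def)

lemma mem_hom_class: "z \<in> cycles \<Delta> i \<Longrightarrow> z \<in> hom_class \<Delta> i z"
  by (simp add: hom_class_def boundaries_zero)

lemma hom_class_eq_zero_iff:
  assumes "z \<in> cycles \<Delta> i"
  shows "hom_class \<Delta> i z = hom_class \<Delta> i (\<lambda>_. 0) \<longleftrightarrow> z \<in> boundaries \<Delta> i"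
proof
  assume "hom_class \<Delta> i z = hom_class \<Delta> i (\<lambda>_. 0)"
  then have "z \<in> hom_class \<Delta> i (\<lambda>_. 0)"
    using mem_hom_class[OF assms] by simp
  then show "z \<in> boundaries \<Delta> i"
    by (simp add: hom_class_def)
next
  assume z: "z \<in> boundaries \<Delta> i"
  have "(\<lambda>xs. w xs - z xs) \<in> boundaries \<Delta> i \<longleftrightarrow> w \<in> boundaries \<Delta> i" for w
  proof -
    have "(\<lambda>xs. w xs - z xs) = w - z" by (auto simp: fun_eq_iff)
    then show ?thesis
      using z fs.subspace_diff[OF subspace_boundaries, of w \<Delta> i z]
        fs.subspace_add[OF subspace_boundaries, of "w - z" \<Delta> i z] by auto
  qed
  then show "hom_class \<Delta> i z = hom_class \<Delta> i (\<lambda>_. 0)"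
    by (simp add: hom_class_def)
qed

lemma homology_zero_dim:
  assumes "abs_complex \<Delta>" "homology_zero \<Delta> i"
  shows "fs.dim (cycles \<Delta> i) = fs.dim (boundaries \<Delta> i)"
proof -
  have "z \<in> boundaries \<Delta> i" if "z \<in> cycles \<Delta> i" for z
  proof -
    have "hom_class \<Delta> i z \<in> red_homology \<Delta> i"
      using that by (simp add: red_homology_def)
    then show ?thesis
      using assms(2) hom_class_eq_zero_iff[OF that] by (simp add: homology_zero_def)
  qed
  then have "cycles \<Delta> i = boundaries \<Delta> i"
    using boundaries_subset_cycles[OF assms(1)] by blast
  then show ?thesis by simp
qed

text \<open>The isomorphism induces a nonzero linear functional F on the cycles whose kernel
  consists of the boundaries. A cycle z0 with F z0 = 1 therefore completes a basis of the boundaries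
  to one of the cycles.\<close>

lemma homology_real_dim:
  fixes k :: nat
  assumes \<Delta>: "abs_complex \<Delta>" and "homology_real \<Delta> i" and i: "i = int k - 1"
  shows "fs.dim (cycles \<Delta> i) = fs.dim (boundaries \<Delta> i) + 1"
proof -
  let ?Z = "cycles \<Delta> i" and ?B = "boundaries \<Delta> i"
  obtain f where bij: "bij_betw f (red_homology \<Delta> i) (UNIV :: real set)"
    and add: "\<And>z w. z \<in> ?Z \<Longrightarrow> w \<in> ?Z \<Longrightarrow>
      f (hom_class \<Delta> i (\<lambda>xs. z xs + w xs)) = f (hom_class \<Delta> i z) + f (hom_class \<Delta> i w)"
    and scale: "\<And>r z. z \<in> ?Z \<Longrightarrow> f (hom_class \<Delta> i (\<lambda>xs. r * z xs)) = r * f (hom_class \<Delta> i z)"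
    using assms(2) unfolding homology_real_def by blast
  define F where "F z = f (hom_class \<Delta> i z)" for z
  have zero: "(\<lambda>_. 0) \<in> ?Z"
    using boundaries_zero boundaries_subset_cycles[OF \<Delta>] by blast
  have F0: "F (\<lambda>_. 0) = 0"
    using scale[OF zero, of 0] by (simp add: F_def)
  have ker: "F z = 0 \<longleftrightarrow> z \<in> ?B" if "z \<in> ?Z" for z
  proof -
    have "F z = F (\<lambda>_. 0) \<longleftrightarrow> hom_class \<Delta> i z = hom_class \<Delta> i (\<lambda>_. 0)"
      unfolding F_def using that zero bij
      by (intro inj_on_eq_iff[of f "red_homology \<Delta> i"]) (auto simp: bij_betw_def red_homology_def)
    then show ?thesis
      using hom_class_eq_zero_iff[OF that] F0 by simp
  qed
  have "1 \<in> f ` red_homology \<Delta> i"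
    using bij by (simp add: bij_betw_def)
  then obtain z0 where z0: "z0 \<in> ?Z" "F z0 = 1"
    by (auto simp: red_homology_def F_def)
  obtain A where A: "A \<subseteq> ?B" "fs.independent A" "?B \<subseteq> fs.span A" "card A = fs.dim ?B"
    by (rule fs.basis_exists)
  have spanA: "fs.span A = ?B"
    using A fs.span_minimal[OF A(1) subspace_boundaries] by auto
  have z0A: "z0 \<notin> fs.span A"
    using z0 ker[OF z0(1)] spanA by simp
  obtain W where "finite W" "chains \<Delta> i \<subseteq> fs.span W"
    using chains_basis(1)[OF \<Delta>, of k] i by auto
  then have "finite A"
    using A(1,2) boundaries_subset_cycles[OF \<Delta>] fs.independent_span_bound[of W A]
    by (auto simp: cycles_def)
  have "?Z \<subseteq> fs.span (insert z0 A)"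
  proof
    fix z assume z: "z \<in> ?Z"
    let ?w = "\<lambda>xs. - F z * z0 xs"
    have w: "?w \<in> ?Z"
      using fs.subspace_scale[OF subspace_cycles z0(1), of "- F z"] by (simp add: fscale_def)
    have "F (\<lambda>xs. z xs + ?w xs) = 0"
      using add[OF z w] scale[OF z0(1), of "- F z"] z0(2) by (simp add: F_def)
    moreover have "(\<lambda>xs. z xs + ?w xs) \<in> ?Z"
      using fs.subspace_add[OF subspace_cycles z w] by (simp add: plus_fun_def)
    ultimately have "(\<lambda>xs. z xs + ?w xs) \<in> fs.span A"
      using ker spanA by blast
    moreover have "(\<lambda>xs. z xs + ?w xs) = z - fscale (F z) z0"
      by (auto simp: fscale_def fun_eq_iff)
    ultimately show "z \<in> fs.span (insert z0 A)"
      using fs.span_breakdown_eq by metis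
  qed
  moreover have "insert z0 A \<subseteq> ?Z"
    using z0 A(1) boundaries_subset_cycles[OF \<Delta>] by blast
  moreover have "fs.independent (insert z0 A)"
    using z0A A(2) by (rule fs.independent_insertI)
  ultimately have "fs.dim ?Z = card (insert z0 A)"
    by (simp add: fs.basis_card_eq_dim)
  moreover have "z0 \<notin> A"
    using z0A fs.span_base by blast
  ultimately show ?thesis
    using \<open>finite A\<close> A(4) by simp
qed

lemma euler_char_acyclic:
  assumes "abs_complex \<Delta>" "\<And>i. homology_zero \<Delta> i"
  shows "(\<Sum>x\<in>\<Delta>. (-1::int) ^ card x) = 0"
proof -
  have "finite \<Delta>" using assms(1) by (simp add: abs_complex_def)
  then have "\<And>x. x \<in> \<Delta> \<Longrightarrow> card x \<le> Max (card ` \<Delta>)" by simp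
  from euler_char_betti[OF assms(1) _ this, of "\<lambda>_. 0"] homology_zero_dim[OF assms] show ?thesis
    by simp
qed

lemma euler_char_sphere:
  assumes "abs_complex \<Delta>"
    and "\<And>i. if i = int d - 1 then homology_real \<Delta> i else homology_zero \<Delta> i"
  shows "(\<Sum>x\<in>\<Delta>. (-1::int) ^ card x) = (-1) ^ d"
proof -
  have "finite \<Delta>" using assms(1) by (simp add: abs_complex_def)
  \<comment> \<open>The bound is raised to at least d so that the only nonzero Betti term lies in
    the range of the sum.\<close>
  then have "\<And>x. x \<in> \<Delta> \<Longrightarrow> card x \<le> max d (Max (card ` \<Delta>))"
    by (simp add: max.coboundedI2)
  moreover have "fs.dim (cycles \<Delta> (int k - 1)) = fs.dim (boundaries \<Delta> (int k - 1)) + (if k = d then 1 else 0)" for k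
    using assms(2)[of "int k - 1"] homology_zero_dim[OF assms(1)] homology_real_dim[OF assms(1)]
    by (auto split: if_splits)
  ultimately have "(\<Sum>x\<in>\<Delta>. (-1::int) ^ card x)
      = (\<Sum>k\<le>max d (Max (card ` \<Delta>)). (-1) ^ k * int (if k = d then 1 else 0))"
    by (intro euler_char_betti[OF assms(1)])
  also have "\<dots> = (\<Sum>k\<le>max d (Max (card ` \<Delta>)). if k = d then (-1) ^ k else 0)"
    by (intro sum.cong) auto
  finally show ?thesis by simp
qed

section \<open>Graded posets\<close>

abbreviation is_chain :: "'a::order set \<Rightarrow> bool" where
  "is_chain \<equiv> Complete_Partial_Order.chain (\<le>)"

lemma is_chain_insert:
  "is_chain K \<Longrightarrow> (\<And>y. y \<in> K \<Longrightarrow> x \<le> y \<or> y \<le> x) \<Longrightarrow> is_chain (insert x K)"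
  unfolding chain_def by auto

lemma is_chain_subset: "is_chain K \<Longrightarrow> L \<subseteq> K \<Longrightarrow> is_chain L"
  unfolding chain_def by blast

lemma rk_ge:
  assumes "finite P" "K \<subseteq> {y \<in> P. y < x}" "is_chain K"
  shows "card K \<le> rk P x"
proof -
  have "finite {K. K \<subseteq> {y \<in> P. y < x} \<and> is_chain K}"
    by (rule finite_subset[of _ "Pow P"]) (use assms(1) in auto)
  then show ?thesis
    unfolding rk_def using assms by (intro Max_ge) auto
qed

lemma rk_attained:
  assumes "finite P"
  obtains K where "K \<subseteq> {y \<in> P. y < x}" "is_chain K" "card K = rk P x"
proof -
  let ?S = "{K. K \<subseteq> {y \<in> P. y < x} \<and> is_chain K}"
  have "finite ?S"
    by (rule finite_subset[of _ "Pow P"]) (use assms in auto)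
  moreover have "{} \<in> ?S"
    by (simp add: chain_def)
  ultimately have "rk P x \<in> card ` ?S"
    unfolding rk_def by (intro Max_in) auto
  then show ?thesis
    using that by auto
qed

lemma rk_less:
  assumes "finite P" "x \<in> P" "x < y"
  shows "rk P x < rk P y"
proof -
  obtain K where K: "K \<subseteq> {y \<in> P. y < x}" "is_chain K" "card K = rk P x"
    using rk_attained[OF assms(1)] by blast
  have "card (insert x K) \<le> rk P y"
    using K assms by (intro rk_ge is_chain_insert) auto
  moreover have "finite K" "x \<notin> K"
    using K(1) finite_subset[OF _ assms(1), of K] by auto
  ultimately show ?thesis
    using K(3) by simp
qed

lemma rk_mono:
  assumes "finite P" "x \<in> P" "x \<le> y"
  shows "rk P x \<le> rk P y"
  using rk_less[OF assms(1,2), of y] assms(3) by (auto simp: order_le_less)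

lemma rk_down_closed:
  assumes "Q \<subseteq> P" "\<And>x y. x \<in> Q \<Longrightarrow> y \<in> P \<Longrightarrow> y \<le> x \<Longrightarrow> y \<in> Q" "x \<in> Q"
  shows "rk Q x = rk P x"
proof -
  have "{y \<in> Q. y < x} = {y \<in> P. y < x}"
    using assms by (auto simp: order_less_imp_le)
  then show ?thesis by (simp add: rk_def)
qed

lemma chain_same_rk:
  assumes "finite P" "x \<in> P" "y \<in> P" "x \<le> y \<or> y \<le> x" "rk P x = rk P y"
  shows "x = y"
  using assms(4,5) rk_less[OF assms(1,2), of y] rk_less[OF assms(1,3), of x]
  by (auto simp: order_le_less)

lemma chain_card_rk:
  assumes "finite P" "K \<subseteq> P" "is_chain K"
  shows "card K = card (rk P ` K)"
proof -
  have "inj_on (rk P) K"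
    using assms chain_same_rk[OF assms(1)] unfolding chain_def by (intro inj_onI) blast
  then show ?thesis by (simp add: card_image)
qed

locale graded =
  fixes n :: nat and P :: "'a::order set"
  assumes graded: "graded_poset n P"
begin

lemma finite_P: "finite P"
  using graded by (simp add: graded_poset_def)

lemma bottom_least: "bottom P \<in> P" "x \<in> P \<Longrightarrow> bottom P \<le> x"
proof -
  obtain z where "z \<in> P" "\<forall>x\<in>P. z \<le> x"
    using graded by (auto simp: graded_poset_def)
  moreover from this have "bottom P = z"
    unfolding bottom_def by (intro Least_equality) auto
  ultimately show "bottom P \<in> P" "x \<in> P \<Longrightarrow> bottom P \<le> x" by auto
qed

lemma rk_bottom: "rk P (bottom P) = 0"
proof -
  obtain K where "K \<subseteq> {y \<in> P. y < bottom P}" "card K = rk P (bottom P)"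
    using rk_attained[OF finite_P] by blast
  moreover have "{y \<in> P. y < bottom P} = {}"
    using bottom_least(2) leD by blast
  ultimately show ?thesis by auto
qed

lemma rk_pos: "x \<in> P \<Longrightarrow> x \<noteq> bottom P \<Longrightarrow> 0 < rk P x"
  using rk_less[OF finite_P bottom_least(1), of x] bottom_least(2)[of x] by (auto simp: order_le_less)

lemma obtain_maximal:
  assumes "x \<in> P"
  obtains M where "M \<in> P" "x \<le> M" "rk P M = n"
proof -
  obtain M where M: "M \<in> P" "x \<le> M" "\<forall>b\<in>P. M \<le> b \<longrightarrow> M = b"
    using finite_has_maximal2[OF finite_P assms] by metis
  then have "\<not> (\<exists>y\<in>P. M < y)"
    by (auto simp: less_le)
  then have "rk P M = n"
    using graded M(1) unfolding graded_poset_def by blast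
  with M that show ?thesis by blast
qed

lemma rk_le:
  assumes "x \<in> P"
  shows "rk P x \<le> n"
proof -
  obtain M where "M \<in> P" "x \<le> M" "rk P M = n"
    by (rule obtain_maximal[OF assms])
  then show ?thesis
    using rk_mono[OF finite_P assms, of M] by simp
qed

text \<open>A maximal element w of the half-open interval is covered by y, so by the grading its
  rank is one less, and the induction continues below w. Leaving out y makes x = y the empty
  case.\<close>

lemma saturated_chain:
  assumes "x \<in> P" "y \<in> P" "x \<le> y"
  obtains K where "K \<subseteq> {z \<in> P. x \<le> z \<and> z < y}" "is_chain K" "rk P ` K = {rk P x..<rk P y}"
proof -
  have "\<exists>K \<subseteq> {z \<in> P. x \<le> z \<and> z < y}. is_chain K \<and> rk P ` K = {rk P x..<rk P y}"
    using assms(2,3)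
  proof (induction "rk P y" arbitrary: y rule: less_induct)
    case less
    show ?case
    proof (cases "x = y")
      case True
      then show ?thesis by (intro exI[of _ "{}"]) (auto simp: chain_def)
    next
      case False
      let ?I = "{z \<in> P. x \<le> z \<and> z < y}"
      have "x \<in> ?I" "finite ?I"
        using False less.prems assms(1) finite_P by auto
      then obtain w where w: "w \<in> ?I" "\<forall>b\<in>?I. w \<le> b \<longrightarrow> w = b"
        using finite_has_maximal2[of ?I x] by blast
      have "\<not> (\<exists>z\<in>P. w < z \<and> z < y)"
      proof
        assume "\<exists>z\<in>P. w < z \<and> z < y"
        then obtain z where z: "z \<in> P" "w < z" "z < y" by blast
        then have "z \<in> ?I" using w by auto
        then show False using w(2) z(2) by auto
      qed
      then have "covers P w y"
        using w less.prems by (simp add: covers_def)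
      then have rk: "rk P y = rk P w + 1"
        using graded by (simp add: graded_poset_def)
      obtain K where K: "K \<subseteq> {z \<in> P. x \<le> z \<and> z < w}" "is_chain K" "rk P ` K = {rk P x..<rk P w}"
        using less.hyps[of w] w rk by auto
      have "insert w K \<subseteq> ?I"
        using K(1) w by auto
      moreover have "is_chain (insert w K)"
        using K by (intro is_chain_insert) auto
      moreover have "rk P ` insert w K = {rk P x..<rk P y}"
        using K(3) rk rk_mono[OF finite_P assms(1), of w] w by auto
      ultimately show ?thesis by blast
    qed
  qed
  then show ?thesis using that by blast
qed

text \<open>The bottom is removed because faces of the order complex omit it. This forces the
  alternative x = \<open>bottom P\<close>, where K is empty.\<close>

lemma lower_saturated_face:
  assumes "x \<in> P"
  obtains K where "K \<subseteq> {z \<in> P - {bottom P}. z \<le> x}" "is_chain K" "rk P ` K = {1..rk P x}"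
    "x = bottom P \<or> x \<in> K"
proof -
  obtain K where K: "K \<subseteq> {z \<in> P. bottom P \<le> z \<and> z < x}" "is_chain K"
      "rk P ` K = {rk P (bottom P)..<rk P x}"
    using saturated_chain[OF bottom_least(1) assms bottom_least(2)[OF assms]] by blast
  define L where "L = insert x K - {bottom P}"
  have "is_chain (insert x K)"
    using K by (intro is_chain_insert) auto
  then have "is_chain L"
    by (rule is_chain_subset) (auto simp: L_def)
  moreover have "L \<subseteq> {z \<in> P - {bottom P}. z \<le> x}"
    using K(1) assms by (auto simp: L_def)
  moreover have "rk P ` L = {1..rk P x}"
  proof -
    have all: "rk P ` insert x K = {0..rk P x}"
      using K(3) by (auto simp: rk_bottom)
    show ?thesis
    proof (intro equalityI subsetI)
      fix k assume "k \<in> rk P ` L"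
      then obtain z where z: "z \<in> L" "k = rk P z" by blast
      then have "z \<in> P" "z \<noteq> bottom P" "k \<in> rk P ` insert x K"
        using K(1) assms by (auto simp: L_def)
      then show "k \<in> {1..rk P x}"
        using rk_pos[of z] z(2) all by auto
    next
      fix k assume k: "k \<in> {1..rk P x}"
      then have "k \<in> rk P ` insert x K" unfolding all by simp
      then show "k \<in> rk P ` L"
        using k rk_bottom by (auto simp: L_def)
    qed
  qed
  moreover have "x = bottom P \<or> x \<in> L"
    by (auto simp: L_def)
  ultimately show ?thesis using that by blast
qed

section \<open>Links of saturated chains\<close>

lemma order_complex_iff: "K \<in> order_complex P \<longleftrightarrow> K \<subseteq> P - {bottom P} \<and> is_chain K"
  using bottom_least(1) by (auto simp: order_complex_def)

text \<open>Comparable elements of equal rank coincide, so a vertex of the link has a rank that K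
  misses. It is thus enough to know the elements of missing rank that are comparable with all of
  K.\<close>

lemma link_order_complex:
  assumes K: "K \<in> order_complex P"
    and I: "I \<subseteq> P - {bottom P} - K" "\<And>z k. z \<in> I \<Longrightarrow> k \<in> K \<Longrightarrow> z \<le> k \<or> k \<le> z"
    and complete: "\<And>z. z \<in> P \<Longrightarrow> z \<noteq> bottom P \<Longrightarrow> rk P z \<notin> rk P ` K \<Longrightarrow>
      (\<And>k. k \<in> K \<Longrightarrow> z \<le> k \<or> k \<le> z) \<Longrightarrow> z \<in> I"
  shows "link (order_complex P) K = {L. L \<subseteq> I \<and> is_chain L}"
proof (intro equalityI subsetI)
  fix L assume "L \<in> link (order_complex P) K"
  then have L: "L \<subseteq> P - {bottom P}" "is_chain L" "K \<inter> L = {}" "is_chain (K \<union> L)"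
    by (auto simp: link_def order_complex_iff)
  have "z \<in> I" if z: "z \<in> L" for z
  proof (rule complete)
    show comp: "z \<le> k \<or> k \<le> z" if "k \<in> K" for k
      using that z L(4) by (auto simp: chain_def)
    show "rk P z \<notin> rk P ` K"
    proof
      assume "rk P z \<in> rk P ` K"
      then obtain k where k: "k \<in> K" "rk P z = rk P k" by blast
      then have "z = k"
        using z L(1) K comp[of k] by (intro chain_same_rk[OF finite_P]) (auto simp: order_complex_iff)
      then show False using k z L(3) by auto
    qed
  qed (use z L in auto)
  then show "L \<in> {L. L \<subseteq> I \<and> is_chain L}"
    using L by blast
next
  fix L assume "L \<in> {L. L \<subseteq> I \<and> is_chain L}"
  then have L: "L \<subseteq> I" "is_chain L" by auto
  have "is_chain (K \<union> L)"
    using L I(2) K unfolding chain_def order_complex_iff by blast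
  then show "L \<in> link (order_complex P) K"
    using L I(1) K by (auto simp: link_def order_complex_iff)
qed

text \<open>K fills all positive ranks up to that of x, so whatever else is comparable with K lies
  strictly above x.\<close>

lemma upper_interval_link:
  assumes x: "x \<in> P"
  obtains K where "K \<in> order_complex P" "card K = rk P x" "\<And>k. k \<in> K \<Longrightarrow> k \<le> x"
    "x = bottom P \<or> x \<in> K"
    "link (order_complex P) K = {L. L \<subseteq> {z \<in> P. x < z} \<and> is_chain L}"
proof -
  obtain K where K: "K \<subseteq> {z \<in> P - {bottom P}. z \<le> x}" "is_chain K" "rk P ` K = {1..rk P x}"
      "x = bottom P \<or> x \<in> K"
    using lower_saturated_face[OF x] by blast
  have face: "K \<in> order_complex P"
    using K by (auto simp: order_complex_iff)
  have "link (order_complex P) K = {L. L \<subseteq> {z \<in> P. x < z} \<and> is_chain L}"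
  proof (rule link_order_complex[OF face])
    show "{z \<in> P. x < z} \<subseteq> P - {bottom P} - K"
      using K(1) bottom_least(2)[OF x] by auto
  next
    fix z assume z: "z \<in> P" "z \<noteq> bottom P" "rk P z \<notin> rk P ` K"
      and comp: "\<And>k. k \<in> K \<Longrightarrow> z \<le> k \<or> k \<le> z"
    have "rk P x < rk P z"
      using z rk_pos[OF z(1,2)] unfolding K(3) by auto
    then have "\<not> z \<le> x"
      using rk_mono[OF finite_P z(1), of x] by auto
    moreover have "z \<le> x \<or> x \<le> z"
      using comp K(4) bottom_least(2)[OF z(1)] by blast
    ultimately show "z \<in> {z \<in> P. x < z}"
      using z(1) by auto
  qed (use K in force)
  moreover have "card K = rk P x"
    using chain_card_rk[OF finite_P _ K(2)] K(1,3) by auto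
  ultimately show ?thesis
    using that face K by blast
qed

text \<open>K joins a saturated chain up to x with a saturated chain from y to a maximal element M,
  so the ranks it misses are those strictly between x and y. Containing M of rank n will keep K out
  of the boundary of a near-Gorenstein* pair.\<close>

lemma open_interval_link:
  assumes x: "x \<in> P" and y: "y \<in> P" and "x < y"
  obtains K M where "K \<in> order_complex P" "card K = rk P x + (n + 1 - rk P y)"
    "M \<in> K" "rk P M = n"
    "link (order_complex P) K = {L. L \<subseteq> {z \<in> P. x < z \<and> z < y} \<and> is_chain L}"
proof -
  obtain K where K: "K \<subseteq> {z \<in> P - {bottom P}. z \<le> x}" "is_chain K" "rk P ` K = {1..rk P x}"
      "x = bottom P \<or> x \<in> K"
    using lower_saturated_face[OF x] by blast
  obtain M where M: "M \<in> P" "y \<le> M" "rk P M = n"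
    using obtain_maximal[OF y] by blast
  obtain J where J: "J \<subseteq> {z \<in> P. y \<le> z \<and> z < M}" "is_chain J" "rk P ` J = {rk P y..<rk P M}"
    using saturated_chain[OF y M(1,2)] by blast
  have yn: "rk P y \<le> n" and xy: "rk P x < rk P y"
    using rk_le[OF y] rk_less[OF finite_P x \<open>x < y\<close>] by auto
  define U where "U = K \<union> insert M J"
  have rkU: "rk P ` U = {1..rk P x} \<union> {rk P y..n}"
    using K(3) J(3) M(3) yn by (auto simp: U_def image_Un)
  have yU: "y \<in> U"
  proof -
    have "rk P ` insert M J = {rk P y..n}"
      using J(3) M(3) yn by auto
    then have "rk P y \<in> rk P ` insert M J"
      using yn by simp
    then obtain j where j: "j \<in> insert M J" "rk P j = rk P y"
      by (metis imageE)
    then have "j \<in> P" "y \<le> j" using J(1) M by auto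
    then have "j = y"
      using chain_same_rk[OF finite_P y, of j] j(2) by simp
    then show ?thesis using j(1) by (auto simp: U_def)
  qed
  have "is_chain (insert M J)"
    using J by (intro is_chain_insert) auto
  moreover have sep: "k < j" if "k \<in> K" "j \<in> insert M J" for k j
  proof -
    have "k \<le> x" "y \<le> j" using that K(1) J(1) M(2) by auto
    then show ?thesis using \<open>x < y\<close> by (meson le_less_trans less_le_trans)
  qed
  ultimately have chainU: "is_chain U"
    using K(2) order_less_imp_le[OF sep] unfolding U_def chain_def by blast
  have "y \<noteq> bottom P"
    using \<open>x < y\<close> bottom_least(2)[OF x] by auto
  then have nb: "z \<noteq> bottom P" if "z \<in> P" "y \<le> z" for z
    using that bottom_least(2)[OF y] by auto
  have face: "U \<in> order_complex P"
    using K(1) J(1) M nb chainU by (auto simp: order_complex_iff U_def)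
  have "link (order_complex P) U = {L. L \<subseteq> {z \<in> P. x < z \<and> z < y} \<and> is_chain L}"
  proof (rule link_order_complex[OF face])
    show "{z \<in> P. x < z \<and> z < y} \<subseteq> P - {bottom P} - U"
      using K(1) J(1) M(2) bottom_least(2)[OF x] by (auto simp: U_def)
  next
    fix z k assume "z \<in> {z \<in> P. x < z \<and> z < y}" "k \<in> U"
    then show "z \<le> k \<or> k \<le> z"
      using K(1) J(1) M(2) by (auto simp: U_def)
  next
    fix z assume z: "z \<in> P" "z \<noteq> bottom P" "rk P z \<notin> rk P ` U"
      and comp: "\<And>k. k \<in> U \<Longrightarrow> z \<le> k \<or> k \<le> z"
    have "rk P x < rk P z" "rk P z < rk P y"
      using z rk_pos[OF z(1,2)] rk_le[OF z(1)] unfolding rkU by auto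
    then have "\<not> z \<le> x" "\<not> y \<le> z"
      using rk_mono[OF finite_P z(1), of x] rk_mono[OF finite_P y, of z] by auto
    moreover have "z \<le> x \<or> x \<le> z"
      using comp K(4) bottom_least(2)[OF z(1)] by (auto simp: U_def)
    moreover have "z \<le> y \<or> y \<le> z"
      using comp yU by blast
    ultimately show "z \<in> {z \<in> P. x < z \<and> z < y}"
      using z(1) by auto
  qed
  moreover have "card U = rk P x + (n + 1 - rk P y)"
  proof -
    have "card U = card ({1..rk P x} \<union> {rk P y..n})"
      using chain_card_rk[OF finite_P _ chainU] face rkU by (simp add: order_complex_iff subset_Diff_insert)
    also have "\<dots> = card {1..rk P x} + card {rk P y..n}"
      using xy by (intro card_Un_disjoint) auto
    finally show ?thesis by simp
  qed
  moreover have "M \<in> U" by (simp add: U_def)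
  ultimately show ?thesis
    using that face M(3) by blast
qed

section \<open>Ranks in upper intervals\<close>

lemma rk_upper_set:
  assumes "x \<in> P" "y \<in> P" "x \<le> y"
  shows "rk (upper_set P x) y = rk P y - rk P x"
proof (rule antisym)
  have fin: "finite (upper_set P x)"
    using finite_P by (simp add: upper_set_def)
  obtain K where K: "K \<subseteq> {z \<in> upper_set P x. z < y}" "is_chain K" "card K = rk (upper_set P x) y"
    using rk_attained[OF fin] by blast
  have "card K = card (rk P ` K)"
    using K by (intro chain_card_rk[OF finite_P]) (auto simp: upper_set_def)
  also have "rk P ` K \<subseteq> {rk P x..<rk P y}"
    using K(1) rk_mono[OF finite_P assms(1)] rk_less[OF finite_P] by (auto simp: upper_set_def)
  then have "card (rk P ` K) \<le> card {rk P x..<rk P y}"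
    by (intro card_mono) auto
  finally show "rk (upper_set P x) y \<le> rk P y - rk P x"
    using K(3) by simp
  obtain J where J: "J \<subseteq> {z \<in> P. x \<le> z \<and> z < y}" "is_chain J" "rk P ` J = {rk P x..<rk P y}"
    using saturated_chain[OF assms] by blast
  have "card J = rk P y - rk P x"
    using chain_card_rk[OF finite_P _ J(2)] J(1,3) by auto
  then show "rk P y - rk P x \<le> rk (upper_set P x) y"
    using rk_ge[OF fin _ J(2), of y] J(1) by (auto simp: upper_set_def)
qed

lemma poset_rank_upper_set:
  assumes "x \<in> P"
  shows "poset_rank (upper_set P x) = n - rk P x"
  unfolding poset_rank_def
proof (rule Max_eqI)
  obtain M where M: "M \<in> P" "x \<le> M" "rk P M = n"
    using obtain_maximal[OF assms] by blast
  then show "n - rk P x \<in> rk (upper_set P x) ` upper_set P x"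
    using rk_upper_set[OF assms M(1,2)] by (force simp: upper_set_def)
  show "k \<le> n - rk P x" if "k \<in> rk (upper_set P x) ` upper_set P x" for k
    using that rk_upper_set[OF assms] rk_le by (auto simp: upper_set_def diff_le_mono)
qed (use finite_P in \<open>simp add: upper_set_def\<close>)

end

section \<open>Eulerian relations\<close>

lemma neg_one_power_cancel: "(-1::int) ^ k * ((-1) ^ k * a) = a"
  by (simp add: minus_one_power_iff)

text \<open>A nonempty chain is its maximum z together with a chain below z, and removing z reverses
  the sign; the 1 is the empty chain.\<close>

lemma chain_sum_by_maximum:
  fixes I :: "'a::order set"
  assumes "finite I"
  shows "(\<Sum>L | L \<subseteq> I \<and> is_chain L. (-1::int) ^ card L)
    = 1 - (\<Sum>z\<in>I. \<Sum>L | L \<subseteq> {w \<in> I. w < z} \<and> is_chain L. (-1) ^ card L)"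
proof -
  let ?S = "\<lambda>z. {L. L \<subseteq> {w \<in> I. w < z} \<and> is_chain L}"
  have finS: "finite (?S z)" for z
    by (rule finite_subset[of _ "Pow I"]) (use assms in auto)
  have notin: "z \<notin> L" if "L \<in> ?S z" for z L
    using that by auto
  have decomp: "{L. L \<subseteq> I \<and> is_chain L} = insert {} (\<Union>z\<in>I. insert z ` ?S z)"
  proof (intro equalityI subsetI)
    fix L assume "L \<in> {L. L \<subseteq> I \<and> is_chain L}"
    then have L: "L \<subseteq> I" "is_chain L" by auto
    show "L \<in> insert {} (\<Union>z\<in>I. insert z ` ?S z)"
    proof (cases "L = {}")
      case False
      have "finite L" using L assms finite_subset by blast
      then obtain z where z: "z \<in> L" "\<forall>b\<in>L. z \<le> b \<longrightarrow> z = b"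
        using finite_has_maximal[of L] False by blast
      then have "w < z" if "w \<in> L - {z}" for w
        using that L(2) unfolding chain_def by (metis Diff_iff insertI1 order_le_less)
      then have "L - {z} \<in> ?S z"
        using L is_chain_subset[OF L(2), of "L - {z}"] by auto
      moreover have "L = insert z (L - {z})" using z by auto
      ultimately have "L \<in> insert z ` ?S z" by (rule image_eqI[rotated])
      then show ?thesis using z L by blast
    qed simp
  next
    fix L assume "L \<in> insert {} (\<Union>z\<in>I. insert z ` ?S z)"
    then consider "L = {}" | z M where "z \<in> I" "L = insert z M" "M \<in> ?S z" by blast
    then show "L \<in> {L. L \<subseteq> I \<and> is_chain L}"
    proof cases
      case 2
      then have "is_chain (insert z M)"
        by (intro is_chain_insert) auto
      with 2 show ?thesis by auto
    qed (simp add: chain_def)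
  qed
  have disj: "insert z ` ?S z \<inter> insert w ` ?S w = {}" if "z \<noteq> w" for z w
  proof -
    have False if "insert z L = insert w M" "L \<in> ?S z" "M \<in> ?S w" for L M
    proof -
      have "w \<in> L" "z \<in> M" using that(1) \<open>z \<noteq> w\<close> by auto
      then have "w < z" "z < w" using that(2,3) by auto
      then show False by (rule less_asym)
    qed
    then show ?thesis by blast
  qed
  have "(\<Sum>L | L \<subseteq> I \<and> is_chain L. (-1::int) ^ card L)
      = 1 + (\<Sum>L\<in>(\<Union>z\<in>I. insert z ` ?S z). (-1) ^ card L)"
    unfolding decomp using assms finS by (subst sum.insert) auto
  also have "(\<Sum>L\<in>(\<Union>z\<in>I. insert z ` ?S z). (-1::int) ^ card L)
      = (\<Sum>z\<in>I. \<Sum>L\<in>insert z ` ?S z. (-1) ^ card L)"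
    using assms finS disj by (intro sum.UNION_disjoint) auto
  also have "\<dots> = (\<Sum>z\<in>I. - (\<Sum>L\<in>?S z. (-1) ^ card L))"
  proof (intro sum.cong refl)
    fix z assume "z \<in> I"
    have inj: "inj_on (insert z) (?S z)"
      using insert_ident[OF notin notin] by (intro inj_onI) blast
    have "card (insert z L) = Suc (card L)" if "L \<in> ?S z" for L
      using that notin[OF that] assms finite_subset[of L I] by (subst card_insert_disjoint) auto
    then show "(\<Sum>L\<in>insert z ` ?S z. (-1::int) ^ card L) = - (\<Sum>L\<in>?S z. (-1) ^ card L)"
      by (simp add: sum.reindex[OF inj] sum_negf)
  qed
  finally show ?thesis by (simp add: sum_negf)
qed

text \<open>The Euler characteristics of links in a near-Gorenstein pair. For \<open>Q = {}\<close> the order complex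
  of \<open>Q\<close> is void, and this is the Gorenstein case.\<close>

locale euler_pair = graded n P for n and P :: "'a::order set" +
  fixes Q :: "'a set"
  assumes sub: "Q \<subseteq> P"
    and down: "\<And>x y. x \<in> Q \<Longrightarrow> y \<in> P \<Longrightarrow> y \<le> x \<Longrightarrow> y \<in> Q"
    and rk_Q: "\<And>x. x \<in> Q \<Longrightarrow> rk P x < n"
    and links: "\<And>K. K \<in> order_complex P \<Longrightarrow>
      (\<Sum>L\<in>link (order_complex P) K. (-1::int) ^ card L)
        = (if K \<in> order_complex Q then 0 else (-1) ^ (n - card K))"
begin

text \<open>By Philip Hall's theorem the left side is minus the Moebius function of the interval, so
  the value says \<mu>(x,y) = (-1)^\<rho>(x,y). The chosen face contains an element of rank n, hence
  does not lie in the boundary.\<close>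

lemma open_interval_sum:
  assumes "x \<in> P" "y \<in> P" "x < y"
  shows "(\<Sum>L | L \<subseteq> {z \<in> P. x < z \<and> z < y} \<and> is_chain L. (-1::int) ^ card L)
    = - ((-1) ^ rk P x * (-1) ^ rk P y)"
proof -
  obtain K M where K: "K \<in> order_complex P" "card K = rk P x + (n + 1 - rk P y)"
      "M \<in> K" "rk P M = n"
      "link (order_complex P) K = {L. L \<subseteq> {z \<in> P. x < z \<and> z < y} \<and> is_chain L}"
    using open_interval_link[OF assms] by blast
  have "M \<notin> Q"
    using rk_Q[of M] K(4) by auto
  then have "K \<notin> order_complex Q"
    using K(3) by (auto simp: order_complex_def)
  then have "(\<Sum>L | L \<subseteq> {z \<in> P. x < z \<and> z < y} \<and> is_chain L. (-1::int) ^ card L)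
      = (-1) ^ (n - card K)"
    using links[OF K(1)] K(5) by simp
  also have "n - card K = rk P y - rk P x - 1"
    using K(2) rk_le[OF assms(2)] rk_less[OF finite_P assms(1,3)] by simp
  also have "(-1::int) ^ \<dots> = - ((-1) ^ rk P x * (-1) ^ rk P y)"
    using rk_less[OF finite_P assms(1,3)] by (auto simp: minus_one_power_iff)
  finally show ?thesis .
qed

text \<open>Sorting the chains of the open interval from x to y by their maximum z leaves the chains
  between x and z, whose sums are known; only the signs of the ranks survive.\<close>

lemma interval_sum:
  assumes "x \<in> P" "y \<in> P" "x < y"
  shows "(\<Sum>z | z \<in> P \<and> x \<le> z \<and> z \<le> y. (-1::int) ^ rk P z) = 0"
proof -
  let ?I = "{z \<in> P. x < z \<and> z < y}"
  have "- ((-1) ^ rk P x * (-1) ^ rk P y) = 1 - (\<Sum>z\<in>?I. \<Sum>L | L \<subseteq> {w \<in> ?I. w < z} \<and> is_chain L. (-1::int) ^ card L)"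
    using open_interval_sum[OF assms] chain_sum_by_maximum[of ?I] finite_P by simp
  also have "(\<Sum>z\<in>?I. \<Sum>L | L \<subseteq> {w \<in> ?I. w < z} \<and> is_chain L. (-1::int) ^ card L)
      = (\<Sum>z\<in>?I. - ((-1) ^ rk P x * (-1) ^ rk P z))"
  proof (intro sum.cong refl)
    fix z assume z: "z \<in> ?I"
    then have "{w \<in> ?I. w < z} = {w \<in> P. x < w \<and> w < z}" by auto
    then show "(\<Sum>L | L \<subseteq> {w \<in> ?I. w < z} \<and> is_chain L. (-1::int) ^ card L)
        = - ((-1) ^ rk P x * (-1) ^ rk P z)"
      using open_interval_sum[of x z] z assms by simp
  qed
  finally have "(-1::int) ^ rk P x * (- ((-1) ^ rk P x * (-1) ^ rk P y))
      = (-1) ^ rk P x * (1 + (-1) ^ rk P x * (\<Sum>z\<in>?I. (-1) ^ rk P z))"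
    by (simp add: sum_negf sum_distrib_left)
  then have "- ((-1::int) ^ rk P y) = (-1) ^ rk P x + (\<Sum>z\<in>?I. (-1) ^ rk P z)"
    by (simp add: distrib_left neg_one_power_cancel)
  moreover have "{z \<in> P. x \<le> z \<and> z \<le> y} = insert x (insert y ?I)"
    using assms by auto
  ultimately show ?thesis
    using finite_P assms by (simp add: sum.insert)
qed

text \<open>For x outside Q this is the Eulerian relation for the interval from x to a formal
  maximum of rank n + 1. For x in Q the relevant link has Euler characteristic zero, and the
  contribution of the formal maximum disappears.\<close>

lemma upper_sum:
  assumes "x \<in> P"
  shows "(\<Sum>z | z \<in> P \<and> x \<le> z. (-1::int) ^ rk P z) = (if x \<in> Q then 0 else (-1) ^ n)"
proof -
  let ?I = "{z \<in> P. x < z}"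
  obtain K where K: "K \<in> order_complex P" "card K = rk P x" "\<And>k. k \<in> K \<Longrightarrow> k \<le> x"
      "x = bottom P \<or> x \<in> K"
      "link (order_complex P) K = {L. L \<subseteq> ?I \<and> is_chain L}"
    using upper_interval_link[OF assms] by blast
  \<comment> \<open>All of K lies below x, and Q is closed downwards. If x is the bottom, K is
    empty, and it is a face of the boundary exactly when Q is nonempty.\<close>
  have KQ: "K \<in> order_complex Q \<longleftrightarrow> x \<in> Q"
  proof
    assume K': "K \<in> order_complex Q"
    then obtain q where q: "q \<in> Q" "K \<subseteq> Q" by (auto simp: order_complex_def)
    then have "bottom P \<in> Q"
      using down[OF q(1) bottom_least(1) bottom_least(2)] sub by auto
    then show "x \<in> Q" using K(4) q by auto
  next
    assume x: "x \<in> Q"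
    then have "bottom P \<in> Q"
      using down bottom_least assms by blast
    then have "bottom Q = bottom P"
      unfolding bottom_def[of Q] using bottom_least(2) sub by (intro Least_equality) auto
    moreover have "K \<subseteq> Q"
      using down[OF x] K(1,3) by (auto simp: order_complex_iff)
    ultimately show "K \<in> order_complex Q"
      using K(1) x by (auto simp: order_complex_def)
  qed
  have "(if x \<in> Q then 0 else (-1) ^ (n - rk P x))
      = 1 - (\<Sum>z\<in>?I. \<Sum>L | L \<subseteq> {w \<in> ?I. w < z} \<and> is_chain L. (-1::int) ^ card L)"
    using links[OF K(1)] chain_sum_by_maximum[of ?I] finite_P by (simp add: K(2,5) KQ)
  also have "(\<Sum>z\<in>?I. \<Sum>L | L \<subseteq> {w \<in> ?I. w < z} \<and> is_chain L. (-1::int) ^ card L)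
      = (\<Sum>z\<in>?I. - ((-1) ^ rk P x * (-1) ^ rk P z))"
  proof (intro sum.cong refl)
    fix z assume z: "z \<in> ?I"
    then have "{w \<in> ?I. w < z} = {w \<in> P. x < w \<and> w < z}" by auto
    then show "(\<Sum>L | L \<subseteq> {w \<in> ?I. w < z} \<and> is_chain L. (-1::int) ^ card L)
        = - ((-1) ^ rk P x * (-1) ^ rk P z)"
      using open_interval_sum[of x z] z assms by simp
  qed
  finally have "(-1::int) ^ rk P x * (if x \<in> Q then 0 else (-1) ^ (n - rk P x))
      = (-1) ^ rk P x * (1 + (-1) ^ rk P x * (\<Sum>z\<in>?I. (-1) ^ rk P z))"
    by (simp add: sum_negf sum_distrib_left)
  then have "(-1::int) ^ rk P x * (if x \<in> Q then 0 else (-1) ^ (n - rk P x))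
      = (-1) ^ rk P x + (\<Sum>z\<in>?I. (-1) ^ rk P z)"
    by (simp add: distrib_left neg_one_power_cancel)
  moreover have "(-1::int) ^ rk P x * (-1) ^ (n - rk P x) = (-1) ^ n"
    using rk_le[OF assms] by (simp flip: power_add)
  moreover have "{z \<in> P. x \<le> z} = insert x ?I"
    using assms by auto
  ultimately show ?thesis
    using finite_P assms by (simp split: if_splits)
qed

end

lemma abs_complex_link:
  assumes "abs_complex \<Delta>"
  shows "abs_complex (link \<Delta> x)"
  unfolding abs_complex_def
proof (intro conjI ballI allI impI)
  show "finite (link \<Delta> x)" "\<And>y. y \<in> link \<Delta> x \<Longrightarrow> finite y"
    using assms by (auto simp: abs_complex_def link_def)
  fix y z assume "y \<in> link \<Delta> x" "z \<subseteq> y"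
  then have "y \<in> \<Delta>" "x \<inter> y = {}" "x \<union> y \<in> \<Delta>" "x \<union> z \<subseteq> x \<union> y" "z \<subseteq> y"
    by (auto simp: link_def)
  moreover have "v \<in> \<Delta>" if "u \<in> \<Delta>" "v \<subseteq> u" for u v
    using that assms unfolding abs_complex_def by blast
  ultimately have "z \<in> \<Delta>" "x \<union> z \<in> \<Delta>" by blast+
  then show "z \<in> link \<Delta> x"
    using \<open>x \<inter> y = {}\<close> \<open>z \<subseteq> y\<close> by (auto simp: link_def)
qed

lemma (in graded) face_card_le:
  assumes "K \<in> order_complex P"
  shows "card K \<le> n"
proof -
  have "card K = card (rk P ` K)"
    using assms by (intro chain_card_rk[OF finite_P]) (auto simp: order_complex_iff)
  also have "rk P ` K \<subseteq> {1..n}"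
    using assms rk_pos rk_le by (force simp: order_complex_iff Suc_le_eq)
  then have "card (rk P ` K) \<le> card {1..n}"
    by (intro card_mono) auto
  finally show ?thesis by simp
qed

lemma gorenstein_star_euler_pair:
  assumes "gorenstein_star n P"
  shows "euler_pair n P {}"
proof -
  interpret graded n P
    using assms by unfold_locales (simp add: gorenstein_star_def)
  have gor: "gorenstein (int n - 1) (order_complex P)"
    using assms by (simp add: gorenstein_star_def)
  show ?thesis
  proof
    fix K assume K: "K \<in> order_complex P"
    have "(\<Sum>L\<in>link (order_complex P) K. (-1::int) ^ card L) = (-1) ^ (n - card K)"
    proof (rule euler_char_sphere)
      show "abs_complex (link (order_complex P) K)"
        using gor by (simp add: gorenstein_def abs_complex_link)
      fix i
      \<comment> \<open>A link of dimension n - 1 - |K|; the truncated subtraction is exact because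
        a face has at most n elements.\<close>
      have "int n - 1 - 1 - face_dim K = int (n - card K) - 1"
        using face_card_le[OF K] by (simp add: face_dim_def)
      then show "if i = int (n - card K) - 1 then homology_real (link (order_complex P) K) i
          else homology_zero (link (order_complex P) K) i"
        using gor K unfolding gorenstein_def by metis
    qed
    then show "(\<Sum>L\<in>link (order_complex P) K. (-1::int) ^ card L)
        = (if K \<in> order_complex {} then 0 else (-1) ^ (n - card K))"
      by (simp add: order_complex_def)
  qed auto
qed

lemma near_gorenstein_star_boundary:
  assumes "near_gorenstein_star m P Q" "Q \<noteq> {}"
  shows "gorenstein_star (m - 1) Q" "0 < m"
proof -
  show "0 < m"
    using assms by (auto simp: near_gorenstein_star_def)
  then have "int m - 1 - 1 = int (m - 1) - 1" by simp
  then show "gorenstein_star (m - 1) Q"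
    using assms \<open>0 < m\<close>
    by (simp add: near_gorenstein_star_def gorenstein_star_def near_gorenstein_def split: if_splits)
qed

lemma near_gorenstein_star_euler_pair:
  assumes "near_gorenstein_star m P Q"
  shows "euler_pair m P Q"
proof -
  interpret graded m P
    using assms by unfold_locales (simp add: near_gorenstein_star_def)
  have near: "near_gorenstein (int m - 1) (order_complex P) (order_complex Q)"
    and down: "\<And>x y. x \<in> Q \<Longrightarrow> y \<in> P \<Longrightarrow> y \<le> x \<Longrightarrow> y \<in> Q" and sub: "Q \<subseteq> P"
    using assms unfolding near_gorenstein_star_def by blast+
  show ?thesis
  proof
    show "Q \<subseteq> P" by (rule sub)
    show "y \<in> Q" if "x \<in> Q" "y \<in> P" "y \<le> x" for x y
      by (rule down[OF that])
    \<comment> \<open>Ranks in a down-closed subset agree with those in P, and the boundary has rank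
      m - 1.\<close>
    show "rk P x < m" if x: "x \<in> Q" for x
    proof -
      have "gorenstein_star (m - 1) Q" "0 < m"
        using near_gorenstein_star_boundary[OF assms] x by auto
      then interpret Q: graded "m - 1" Q
        by unfold_locales (simp add: gorenstein_star_def)
      have "rk Q x = rk P x"
        by (rule rk_down_closed[OF sub down x])
      then show ?thesis
        using Q.rk_le[OF x] \<open>0 < m\<close> by simp
    qed
    fix K assume K: "K \<in> order_complex P"
    have abs: "abs_complex (link (order_complex P) K)"
      using near by (simp add: near_gorenstein_def abs_complex_link)
    have dim: "int m - 1 - 1 - face_dim K = int (m - card K) - 1"
      using face_card_le[OF K] by (simp add: face_dim_def)
    have hom: "if i = int (m - card K) - 1 \<and> K \<notin> order_complex Q
          then homology_real (link (order_complex P) K) i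
          else homology_zero (link (order_complex P) K) i" for i
      using near K unfolding near_gorenstein_def dim[symmetric] by blast
    show "(\<Sum>L\<in>link (order_complex P) K. (-1::int) ^ card L)
        = (if K \<in> order_complex Q then 0 else (-1) ^ (m - card K))"
    proof (cases "K \<in> order_complex Q")
      case True
      then show ?thesis
        using euler_char_acyclic[OF abs] hom by simp
    next
      case False
      then show ?thesis
        using euler_char_sphere[OF abs, of "m - card K"] hom by simp
    qed
  qed
qed

section \<open>Flag sums\<close>

definition flags :: "'a::order set \<Rightarrow> 'a \<Rightarrow> 'a list set" where
  "flags P x = {xs. xs \<noteq> [] \<and> set xs \<subseteq> P \<and> sorted_wrt (<) xs \<and> hd xs = x}"

text \<open>The weight without its last power of a - b. That power alone depends on the rank of the
  formal maximum, which differs between a poset, its boundary and the preimages.\<close>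

fun flag_wt :: "('a \<Rightarrow> nat) \<Rightarrow> 'a list \<Rightarrow> ab_poly" where
  "flag_wt r [] = 1"
| "flag_wt r [x] = 1"
| "flag_wt r (x # y # xs) = (pa - pb) ^ (r y - r x - 1) * pb * flag_wt r (y # xs)"

text \<open>The formal maximum has rank N + 1, which gives the exponent
  \<open>N - r (last xs)\<close>. Keeping r as a parameter allows the rank function of a surrounding
  poset.\<close>

definition flag_sum :: "('a::order \<Rightarrow> nat) \<Rightarrow> nat \<Rightarrow> 'a set \<Rightarrow> 'a \<Rightarrow> ab_poly" where
  "flag_sum r N P x = (\<Sum>xs\<in>flags P x. flag_wt r xs * (pa - pb) ^ (N - r (last xs)))"

lemma finite_flags:
  assumes "finite P"
  shows "finite (flags P x)"
proof (rule finite_subset)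
  show "flags P x \<subseteq> {xs. set xs \<subseteq> P \<and> length xs \<le> card P}"
  proof
    fix xs assume "xs \<in> flags P x"
    then have xs: "set xs \<subseteq> P" "sorted_wrt (<) xs" by (auto simp: flags_def)
    have "distinct xs"
      using xs(2) by (induction xs) auto
    then have "length xs \<le> card P"
      using card_mono[OF assms xs(1)] by (simp add: distinct_card)
    with xs(1) show "xs \<in> {xs. set xs \<subseteq> P \<and> length xs \<le> card P}" by simp
  qed
qed (rule finite_lists_length_le[OF assms])

lemma flags_rec:
  assumes "x \<in> P"
  shows "flags P x = insert [x] (\<Union>z\<in>{z \<in> P. x < z}. (#) x ` flags P z)"
proof (intro equalityI subsetI)
  fix xs assume "xs \<in> flags P x"
  then obtain ys where ys: "xs = x # ys" "set ys \<subseteq> P" "sorted_wrt (<) (x # ys)"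
    by (cases xs) (auto simp: flags_def)
  show "xs \<in> insert [x] (\<Union>z\<in>{z \<in> P. x < z}. (#) x ` flags P z)"
  proof (cases ys)
    case (Cons z zs)
    then have "ys \<in> flags P z" "z \<in> P" "x < z"
      using ys by (auto simp: flags_def)
    then show ?thesis using ys(1) by blast
  qed (simp add: ys)
next
  fix xs assume "xs \<in> insert [x] (\<Union>z\<in>{z \<in> P. x < z}. (#) x ` flags P z)"
  then consider "xs = [x]" | z ys where "z \<in> P" "x < z" "xs = x # ys" "ys \<in> flags P z"
    by blast
  then show "xs \<in> flags P x"
  proof cases
    case 2
    then obtain zs where "ys = z # zs"
      by (cases ys) (auto simp: flags_def)
    with 2 assms show ?thesis
      by (auto simp: flags_def)
  qed (use assms in \<open>simp add: flags_def\<close>)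
qed

text \<open>The flags other than the single element x are sorted by their second element z; deleting
  x then leaves an arbitrary flag starting at z.\<close>

lemma flag_sum_rec:
  assumes fin: "finite P" and x: "x \<in> P"
  shows "flag_sum r N P x = (pa - pb) ^ (N - r x)
    + (\<Sum>z | z \<in> P \<and> x < z. (pa - pb) ^ (r z - r x - 1) * pb * flag_sum r N P z)"
proof -
  let ?w = "\<lambda>xs. flag_wt r xs * (pa - pb) ^ (N - r (last xs))" and ?U = "{z \<in> P. x < z}"
  have finU: "finite ?U" using fin by simp
  have "flag_sum r N P x = ?w [x] + (\<Sum>xs\<in>(\<Union>z\<in>?U. (#) x ` flags P z). ?w xs)"
    unfolding flag_sum_def flags_rec[OF x] using fin finite_flags[OF fin]
    by (subst sum.insert) (auto simp: flags_def)
  also have "(\<Sum>xs\<in>(\<Union>z\<in>?U. (#) x ` flags P z). ?w xs) = (\<Sum>z\<in>?U. \<Sum>xs\<in>(#) x ` flags P z. ?w xs)"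
    using finU finite_flags[OF fin] by (intro sum.UNION_disjoint) (auto simp: flags_def)
  also have "\<dots> = (\<Sum>z\<in>?U. (pa - pb) ^ (r z - r x - 1) * pb * flag_sum r N P z)"
  proof (intro sum.cong refl)
    fix z
    have "?w (x # ys) = (pa - pb) ^ (r z - r x - 1) * pb * ?w ys" if ys: "ys \<in> flags P z" for ys
    proof -
      obtain zs where "ys = z # zs"
        using ys by (cases ys) (auto simp: flags_def)
      then show ?thesis by (simp add: mult.assoc)
    qed
    then have "(\<Sum>xs\<in>(#) x ` flags P z. ?w xs)
        = (\<Sum>ys\<in>flags P z. (pa - pb) ^ (r z - r x - 1) * pb * ?w ys)"
      by (subst sum.reindex) (auto intro: inj_onI)
    then show "(\<Sum>xs\<in>(#) x ` flags P z. ?w xs) = (pa - pb) ^ (r z - r x - 1) * pb * flag_sum r N P z"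
      by (simp only: flag_sum_def sum_distrib_left)
  qed
  finally show ?thesis by simp
qed

text \<open>Weights depend on rank differences only, so the intrinsic ranks of an upper interval may
  be replaced by the ranks of the whole poset.\<close>

lemma chain_wt_eq_flag_wt:
  assumes "xs \<noteq> []" "\<And>x y. x \<in> set xs \<Longrightarrow> y \<in> set xs \<Longrightarrow> rk P y - rk P x = r y - r x"
    and "\<And>x. x \<in> set xs \<Longrightarrow> poset_rank P - rk P x = N - r x"
  shows "chain_wt P xs = flag_wt r xs * (pa - pb) ^ (N - r (last xs))"
  using assms
proof (induction xs rule: induct_list012)
  case (3 x y zs)
  have "chain_wt P (y # zs) = flag_wt r (y # zs) * (pa - pb) ^ (N - r (last (y # zs)))"
    by (rule "3.IH"(2)) (use "3.prems" in auto)
  then show ?case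
    using "3.prems"(2)[of x y] by (simp add: mult.assoc)
qed simp_all

lemma (in graded) ab_index_upper_set:
  assumes "x \<in> P"
  shows "ab_index (upper_set P x) = flag_sum (rk P) n P x"
proof -
  have "bottom (upper_set P x) = x"
    unfolding bottom_def using assms by (intro Least_equality) (auto simp: upper_set_def)
  moreover have "x \<le> y" if "xs \<in> flags P x" "y \<in> set xs" for xs y
    using that by (cases xs) (auto simp: flags_def order_less_imp_le)
  then have "set xs \<subseteq> upper_set P x" if "xs \<in> flags P x" for xs
    using that by (auto simp: flags_def upper_set_def)
  ultimately have rooted: "rooted_chains (upper_set P x) = flags P x"
    by (auto simp: rooted_chains_def flags_def upper_set_def)
  show ?thesis
    unfolding ab_index_def flag_sum_def rooted
  proof (intro sum.cong refl chain_wt_eq_flag_wt)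
    fix xs assume "xs \<in> flags P x"
    then have xs: "xs \<noteq> []" "set xs \<subseteq> upper_set P x"
      unfolding rooted[symmetric] by (auto simp: rooted_chains_def)
    show "xs \<noteq> []" by fact
    have rk: "rk (upper_set P x) y = rk P y - rk P x" "rk P x \<le> rk P y" if "y \<in> set xs" for y
      using that xs(2) rk_upper_set[OF assms, of y] rk_mono[OF finite_P assms, of y]
      by (auto simp: upper_set_def)
    show "rk (upper_set P x) z - rk (upper_set P x) y = rk P z - rk P y"
      if "y \<in> set xs" "z \<in> set xs" for y z
      using rk[OF that(1)] rk[OF that(2)] by simp
    show "poset_rank (upper_set P x) - rk (upper_set P x) y = n - rk P y" if "y \<in> set xs" for y
      using rk[OF that] poset_rank_upper_set[OF assms] by simp
  qed
qed

lemma (in graded) upper_set_bottom: "upper_set P (bottom P) = P"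
  using bottom_least(2) by (auto simp: upper_set_def)

lemma (in graded) ab_index_eq_flag_sum: "ab_index P = flag_sum (rk P) n P (bottom P)"
  using ab_index_upper_set[OF bottom_least(1)] unfolding upper_set_bottom .

lemma ab_index_empty: "ab_index {} = 0"
  by (simp add: ab_index_def rooted_chains_def)

lemma flag_sum_cong:
  assumes "\<And>z. z \<in> P \<Longrightarrow> r z = r' z"
  shows "flag_sum r N P x = flag_sum r' N P x"
  unfolding flag_sum_def
proof (intro sum.cong refl arg_cong2[of _ _ _ _ "(*)"])
  fix xs assume "xs \<in> flags P x"
  then have xs: "set xs \<subseteq> P" "xs \<noteq> []" by (auto simp: flags_def)
  show "flag_wt r xs = flag_wt r' xs"
    using xs(1) assms by (induction xs rule: induct_list012) auto
  show "(pa - pb) ^ (N - r (last xs)) = (pa - pb) ^ (N - r' (last xs))"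
    using assms xs by (simp add: subset_iff)
qed

text \<open>The condition is restricted to nonempty Q so that a Gorenstein* poset with empty
  boundary and a pair of rank 0 are covered as well.\<close>

locale euler_pair_boundary = euler_pair n P Q for n and P Q :: "'a::order set" +
  assumes boundary: "Q \<noteq> {} \<Longrightarrow> euler_pair (n - 1) Q {}"
begin

lemma rk_boundary: "x \<in> Q \<Longrightarrow> rk Q x = rk P x"
  by (rule rk_down_closed[OF sub], rule down)

lemma boundary_upper_sum:
  assumes "x \<in> Q"
  shows "(\<Sum>z | z \<in> Q \<and> x \<le> z. (-1::int) ^ rk P z) = (-1) ^ (n - 1)"
proof -
  interpret Q: euler_pair "n - 1" Q "{}"
    using boundary assms by blast
  have "(\<Sum>z | z \<in> Q \<and> x \<le> z. (-1::int) ^ rk P z) = (\<Sum>z | z \<in> Q \<and> x \<le> z. (-1) ^ rk Q z)"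
    by (rule sum.cong) (auto simp: rk_boundary)
  then show ?thesis
    using Q.upper_sum[OF assms] by simp
qed

text \<open>The polynomial \<Phi> of the part of the pair above x. Only the value at the bottom
  belongs to the pair itself, but the recursion runs through all x.\<close>

definition Phi :: "'a \<Rightarrow> ab_poly" where
  "Phi x = flag_sum (rk P) n P x - (if x \<in> Q then flag_sum (rk P) (n - 1) Q x * pa else 0)"

lemma sum_boundary:
  fixes f :: "'a \<Rightarrow> ab_poly"
  shows "(\<Sum>z | z \<in> P \<and> R z. if z \<in> Q then f z else 0) = (\<Sum>z | z \<in> Q \<and> R z. f z)"
proof -
  have "{z \<in> {z \<in> P. R z}. z \<in> Q} = {z \<in> Q. R z}"
    using sub by auto
  then show ?thesis
    using finite_P by (simp flip: sum.inter_filter)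
qed

text \<open>The flag sums of P and of Q obey the same recursion, hence so does their combination,
  with start term T. Put k = n - \<rho>(x). The start term plus its transform is e^k + (-e)^k
  outside Q; inside Q it is e^k for even k and -e^(k-1) c for odd k.\<close>

lemma Phi_in_CD:
  assumes "x \<in> P"
  shows "Phi x \<in> CD"
proof -
  define e where "e = pa - pb"
  define T where "T x = e ^ (n - rk P x) - (if x \<in> Q then e ^ (n - 1 - rk P x) * pa else 0)" for x
  show ?thesis
  proof (rule eulerian_recursion_in_CD[where r = "rk P" and T = T, OF finite_P _ _ _ _ assms])
    show "rk P x < rk P y" if "x \<in> P" "y \<in> P" "x < y" for x y
      using rk_less[OF finite_P that(1,3)] .
    show "(\<Sum>z | z \<in> P \<and> x \<le> z \<and> z \<le> y. (-1::int) ^ rk P z) = 0" if "x \<in> P" "y \<in> P" "x < y" for x y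
      by (rule interval_sum[OF that])
  next
    fix x assume x: "x \<in> P"
    let ?c = "\<lambda>z. e ^ (rk P z - rk P x - 1) * pb"
    have "(\<Sum>z | z \<in> P \<and> x < z. ?c z * Phi z) = (\<Sum>z | z \<in> P \<and> x < z. ?c z * flag_sum (rk P) n P z)
        - (\<Sum>z | z \<in> P \<and> x < z. if z \<in> Q then ?c z * flag_sum (rk P) (n - 1) Q z * pa else 0)"
      unfolding sum_subtractf[symmetric] Phi_def
      by (intro sum.cong refl) (auto simp: right_diff_distrib mult.assoc)
    also have "(\<Sum>z | z \<in> P \<and> x < z. if z \<in> Q then ?c z * flag_sum (rk P) (n - 1) Q z * pa else 0)
        = (\<Sum>z | z \<in> Q \<and> x < z. ?c z * flag_sum (rk P) (n - 1) Q z) * pa"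
      by (simp add: sum_boundary sum_distrib_right)
    also have "\<dots> = (if x \<in> Q then flag_sum (rk P) (n - 1) Q x * pa - e ^ (n - 1 - rk P x) * pa else 0)"
    proof (cases "x \<in> Q")
      case True
      then show ?thesis
        using flag_sum_rec[OF finite_subset[OF sub finite_P] True, of "rk P" "n - 1"]
        by (simp add: e_def distrib_right)
    next
      case False
      \<comment> \<open>A down-closed Q has nothing above an element outside Q, so no boundary terms
        arise.\<close>
      then have E: "{z \<in> Q. x < z} = {}"
        using x down by (blast dest: order_less_imp_le)
      show ?thesis unfolding E using False by simp
    qed
    finally show "Phi x = T x + (\<Sum>z | z \<in> P \<and> x < z. (pa - pb) ^ (rk P z - rk P x - 1) * pb * Phi z)"
      using flag_sum_rec[OF finite_P x, of "rk P" n] by (simp add: Phi_def T_def e_def)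
  next
    fix x assume x: "x \<in> P"
    define k where "k = n - rk P x"
    let ?V = "{z \<in> P. x \<le> z}"
    have le: "rk P x \<le> rk P z \<and> rk P z \<le> n" if "z \<in> ?V" for z
      using that rk_mono[OF finite_P x, of z] rk_le[of z] by auto
    have "(\<Sum>z\<in>?V. (- e) ^ (rk P z - rk P x) * T z) =
        (\<Sum>z\<in>?V. (- e) ^ (rk P z - rk P x) * e ^ (n - rk P z))
        - (\<Sum>z\<in>?V. if z \<in> Q then (- e) ^ (rk P z - rk P x) * e ^ (n - 1 - rk P z) * pa else 0)"
      unfolding sum_subtractf[symmetric] T_def
      by (intro sum.cong refl) (auto simp: right_diff_distrib mult.assoc)
    also have "(\<Sum>z\<in>?V. (- e) ^ (rk P z - rk P x) * e ^ (n - rk P z))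
        = of_int ((-1) ^ rk P x * (if x \<in> Q then 0 else (-1) ^ n)) * e ^ k"
      unfolding upper_sum[OF x, symmetric] k_def by (rule neg_power_sum[OF le])
    also have "(-1::int) ^ rk P x * (if x \<in> Q then 0 else (-1) ^ n) = (if x \<in> Q then 0 else (-1) ^ k)"
      using rk_le[OF x] by (auto simp: k_def minus_one_power_iff)
    also have "(\<Sum>z\<in>?V. if z \<in> Q then (- e) ^ (rk P z - rk P x) * e ^ (n - 1 - rk P z) * pa else 0)
        = (\<Sum>z | z \<in> Q \<and> x \<le> z. (- e) ^ (rk P z - rk P x) * e ^ (n - 1 - rk P z)) * pa"
      by (simp add: sum_boundary sum_distrib_right)
    finally have T': "(\<Sum>z\<in>?V. (- e) ^ (rk P z - rk P x) * T z)
        = of_int (if x \<in> Q then 0 else (-1) ^ k) * e ^ k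
          - (\<Sum>z | z \<in> Q \<and> x \<le> z. (- e) ^ (rk P z - rk P x) * e ^ (n - 1 - rk P z)) * pa" .
    have "T x + (\<Sum>z\<in>?V. (- e) ^ (rk P z - rk P x) * T z) \<in> CD"
    proof (cases "x \<in> Q")
      case False
      then have E: "{z \<in> Q. x \<le> z} = {}"
        using x down by blast
      have *: "T x + (\<Sum>z\<in>?V. (- e) ^ (rk P z - rk P x) * T z) = e ^ k + (-1) ^ k * e ^ k"
        unfolding T' E using False by (simp add: T_def k_def)
      show ?thesis
        unfolding * by (cases "even k") (simp_all add: e_def CD_zero CD_add CD_even_power)
    next
      case True
      have k: "0 < k" "n - 1 - rk P x = k - 1" "n - Suc (rk P x) = k - 1"
        using rk_Q[OF True] by (auto simp: k_def)
      have "(\<Sum>z | z \<in> Q \<and> x \<le> z. (- e) ^ (rk P z - rk P x) * e ^ (n - 1 - rk P z))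
          = of_int ((-1) ^ rk P x * (-1) ^ (n - 1)) * e ^ (n - 1 - rk P x)"
        unfolding boundary_upper_sum[OF True, symmetric]
      proof (rule neg_power_sum)
        fix z assume z: "z \<in> {z \<in> Q. x \<le> z}"
        then show "rk P x \<le> rk P z \<and> rk P z \<le> n - 1"
          using le[of z] rk_Q[of z] sub by auto
      qed
      also have "(-1::int) ^ rk P x * (-1) ^ (n - 1) = (-1) ^ (k - 1)"
        using rk_Q[OF True] by (auto simp: k_def minus_one_power_iff)
      \<comment> \<open>The first part of the transform vanishes because the alternating sum above a
        boundary element is zero; the boundary part contributes the opposite or the same term as T
        x, according to the parity of k.\<close>
      finally have *: "T x + (\<Sum>z\<in>?V. (- e) ^ (rk P z - rk P x) * T z)
          = e ^ k - e ^ (k - 1) * pa - (-1) ^ (k - 1) * e ^ (k - 1) * pa"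
        unfolding T' using True by (simp add: T_def k flip: k_def)
      show ?thesis
      proof (cases "even k")
        case True
        then have "(-1::ab_poly) ^ (k - 1) = -1"
          using k(1) by (simp add: minus_one_power_iff)
        with True show ?thesis
          unfolding * by (simp add: e_def CD_even_power)
      next
        case False
        then have sgn: "(-1::ab_poly) ^ (k - 1) = 1" and even: "even (k - 1)"
          by (simp_all add: minus_one_power_iff)
        have "e ^ k = e ^ (k - 1) * e"
          using k(1) by (metis Suc_diff_1 power_Suc2)
        then have "e ^ k - e ^ (k - 1) * pa - (-1) ^ (k - 1) * e ^ (k - 1) * pa
            = - (e ^ (k - 1) * (pa + pb))"
          unfolding sgn by (simp add: e_def algebra_simps)
        moreover have "- (e ^ (k - 1) * (pa + pb)) \<in> CD"
          unfolding e_def by (intro CD_uminus CD_mult CD_c CD_even_power even)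
        ultimately show ?thesis
          unfolding * by simp
      qed
    qed
    then show "T x + (\<Sum>z | z \<in> P \<and> x \<le> z. (- (pa - pb)) ^ (rk P z - rk P x) * T z) \<in> CD"
      by (simp add: e_def)
  qed
qed

end

section \<open>Existence of the cd-indices\<close>

lemma gorenstein_star_cd_index:
  assumes "gorenstein_star n P" "x \<in> P"
  shows "ab_index (upper_set P x) \<in> CD"
proof -
  interpret euler_pair n P "{}"
    by (rule gorenstein_star_euler_pair[OF assms(1)])
  interpret euler_pair_boundary n P "{}"
    by unfold_locales auto
  show ?thesis
    \<comment> \<open>With empty boundary \<open>Phi x\<close> is the ab-index of the upper interval
      at x, so all upper intervals are handled at once without showing that each is
      Gorenstein*.\<close>
    using Phi_in_CD[OF assms(2)] ab_index_upper_set[OF assms(2)] by (simp add: Phi_def)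
qed

lemma near_gorenstein_star_cd_index:
  assumes near: "near_gorenstein_star m P Q"
  shows "ab_index P - ab_index Q * pa \<in> CD"
proof -
  interpret euler_pair m P Q
    by (rule near_gorenstein_star_euler_pair[OF near])
  interpret euler_pair_boundary m P Q
    by (intro euler_pair_boundary.intro euler_pair_boundary_axioms.intro euler_pair_axioms
        gorenstein_star_euler_pair near_gorenstein_star_boundary(1)[OF near])
  have "ab_index Q = (if bottom P \<in> Q then flag_sum (rk P) (m - 1) Q (bottom P) else 0)"
  proof (cases "Q = {}")
    case True
    then show ?thesis by (simp add: ab_index_empty)
  next
    case False
    then obtain q where "q \<in> Q" by blast
    then have bot: "bottom P \<in> Q"
      using down bottom_least sub by blast
    then have "bottom Q = bottom P"
      unfolding bottom_def[of Q] using bottom_least(2) sub by (intro Least_equality) auto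
    moreover interpret Q: graded "m - 1" Q
      using near_gorenstein_star_boundary(1)[OF near False]
      by unfold_locales (simp add: gorenstein_star_def)
    have "flag_sum (rk Q) (m - 1) Q (bottom P) = flag_sum (rk P) (m - 1) Q (bottom P)"
      by (rule flag_sum_cong) (rule rk_boundary)
    ultimately show ?thesis
      using bot Q.ab_index_eq_flag_sum by simp
  qed
  then show ?thesis
    using Phi_in_CD[OF bottom_least(1)] ab_index_eq_flag_sum by (simp add: Phi_def split: if_splits)
qed

section \<open>The decomposition\<close>

text \<open>The last element of a flag is its largest, so it decides whether the whole flag lies in
  a down-closed subset.\<close>

lemma flags_down_closed:
  assumes "Q \<subseteq> P" "\<And>x y. x \<in> Q \<Longrightarrow> y \<in> P \<Longrightarrow> y \<le> x \<Longrightarrow> y \<in> Q"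
  shows "flags Q x = {xs \<in> flags P x. last xs \<in> Q}"
proof (intro equalityI subsetI)
  fix xs assume "xs \<in> {xs \<in> flags P x. last xs \<in> Q}"
  then have xs: "xs \<in> flags P x" "last xs \<in> Q" "xs \<noteq> []" "set xs \<subseteq> P" "sorted_wrt (<) xs"
    by (auto simp: flags_def)
  have "y \<le> last xs" if "y \<in> set xs" for y
    using that xs(5) by (induction xs) (auto simp: order_less_imp_le)
  then have "set xs \<subseteq> Q"
    using xs assms(2) by blast
  then show "xs \<in> flags Q x"
    using xs(1) by (simp add: flags_def)
qed (use assms(1) in \<open>auto simp: flags_def\<close>)

text \<open>Flags are sorted by the image t of their last element. Because r y \<le>
  \<rho>(\<phi>(y)) \<le> N, the final exponent splits at \<rho>(t), and the inner sum no longer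
  depends on Q or N. It can thus be shared by all preimages.\<close>

lemma flag_sum_fiberwise:
  fixes \<phi> :: "'a::order \<Rightarrow> 'b"
  assumes fin: "finite P" "finite E"
    and Q: "Q \<subseteq> P" "\<And>x y. x \<in> Q \<Longrightarrow> y \<in> P \<Longrightarrow> y \<le> x \<Longrightarrow> y \<in> Q" "\<And>y. y \<in> P \<Longrightarrow> y \<in> Q \<longleftrightarrow> \<phi> y \<in> E"
    and le: "\<And>y. y \<in> P \<Longrightarrow> r y \<le> \<rho> (\<phi> y)" "\<And>t. t \<in> E \<Longrightarrow> \<rho> t \<le> N"
  shows "flag_sum r N Q x = (\<Sum>t\<in>E. (\<Sum>xs | xs \<in> flags P x \<and> \<phi> (last xs) = t.
      flag_wt r xs * (pa - pb) ^ (\<rho> t - r (last xs))) * (pa - pb) ^ (N - \<rho> t))"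
proof -
  have last: "last xs \<in> P" if "xs \<in> flags P x" for xs
    using that by (auto simp: flags_def)
  have "flags Q x = {xs \<in> flags P x. last xs \<in> Q}"
    by (rule flags_down_closed) (use Q(1,2) in blast)+
  then have fl: "flags Q x = {xs \<in> flags P x. \<phi> (last xs) \<in> E}"
    using Q(3)[OF last] by auto
  have "flag_sum r N Q x = (\<Sum>t\<in>E. \<Sum>xs | xs \<in> flags Q x \<and> \<phi> (last xs) = t.
      flag_wt r xs * (pa - pb) ^ (N - r (last xs)))"
    unfolding flag_sum_def
    using finite_flags[OF fin(1), of x] fin(2) by (intro sum.group[symmetric]) (auto simp: fl)
  also have "\<dots> = (\<Sum>t\<in>E. (\<Sum>xs | xs \<in> flags P x \<and> \<phi> (last xs) = t.
      flag_wt r xs * (pa - pb) ^ (\<rho> t - r (last xs))) * (pa - pb) ^ (N - \<rho> t))"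
    unfolding sum_distrib_right
  proof (intro sum.cong)
    fix t assume t: "t \<in> E"
    then show "{xs \<in> flags Q x. \<phi> (last xs) = t} = {xs \<in> flags P x. \<phi> (last xs) = t}"
      by (auto simp: fl)
    fix xs assume "xs \<in> {xs \<in> flags P x. \<phi> (last xs) = t}"
    then have "r (last xs) \<le> \<rho> t"
      using le(1)[OF last] by auto
    then have "N - r (last xs) = (\<rho> t - r (last xs)) + (N - \<rho> t)"
      using le(2)[OF t] by simp
    then show "flag_wt r xs * (pa - pb) ^ (N - r (last xs))
        = flag_wt r xs * (pa - pb) ^ (\<rho> t - r (last xs)) * (pa - pb) ^ (N - \<rho> t)"
      by (simp add: power_add mult.assoc)
  qed simp
  finally show ?thesis .
qed

text \<open>With \<open>h t\<close> the weighted sum over the flags of the source whose last element lies over \<open>t\<close>,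
  the polynomials \<open>\<Phi>\<close> are \<open>h(s) - \<Sum>\<^bsub>t < s\<^esub> h(t) (a-b)^(\<rho>(t,s)-1) b\<close>. Inserting the recursion for the
  \<open>ab\<close>-index of upper intervals, the sum telescopes.\<close>

lemma ab_index_subdivision:
  fixes \<phi> :: "'a::order \<Rightarrow> 'b::order"
  assumes sd: "subdivision n \<phi> P' P"
  shows "ab_index P' = (\<Sum>s\<in>P. (ab_index (closed_preimage \<phi> P' s)
      - ab_index (open_preimage \<phi> P' s) * pa) * ab_index (upper_set P s))"
proof -
  interpret P': graded n P'
    using sd by unfold_locales (simp add: subdivision_def gorenstein_star_def)
  interpret P: graded n P
    using sd by unfold_locales (simp add: subdivision_def gorenstein_star_def)
  have surj: "\<phi> ` P' = P" and mono: "mono_on P' \<phi>"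
    and near: "\<And>s. s \<in> P \<Longrightarrow> near_gorenstein_star (rk P s) (closed_preimage \<phi> P' s) (open_preimage \<phi> P' s)"
    using sd by (auto simp: subdivision_def)
  let ?r = "rk P'" and ?\<rho> = "rk P" and ?b = "bottom P'"
  have \<phi>_mono: "\<phi> x \<le> \<phi> y" if "x \<in> P'" "y \<in> P'" "x \<le> y" for x y
    using mono_onD[OF mono that] .
  have \<phi>_in: "\<phi> x \<in> P" if "x \<in> P'" for x
    using that surj by auto
  define e where "e = pa - pb"
  define h where "h t = (\<Sum>xs | xs \<in> flags P' ?b \<and> \<phi> (last xs) = t.
      flag_wt ?r xs * e ^ (?\<rho> t - ?r (last xs)))" for t
  define F where "F s = flag_sum ?\<rho> n P s" for s
  have closed: "closed_preimage \<phi> P' s \<subseteq> P'" "open_preimage \<phi> P' s \<subseteq> P'" for s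
    by (auto simp: closed_preimage_def open_preimage_def)
  have down: "y \<in> closed_preimage \<phi> P' s" if "x \<in> closed_preimage \<phi> P' s" "y \<in> P'" "y \<le> x" for x y s
    using that \<phi>_mono[of y x] by (auto simp: closed_preimage_def)
  have down': "y \<in> open_preimage \<phi> P' s" if "x \<in> open_preimage \<phi> P' s" "y \<in> P'" "y \<le> x" for x y s
    using that \<phi>_mono[of y x] by (auto simp: open_preimage_def)
  have ab: "ab_index X = flag_sum ?r N X ?b"
    if "graded_poset N X" "X \<subseteq> P'" "\<And>x y. x \<in> X \<Longrightarrow> y \<in> P' \<Longrightarrow> y \<le> x \<Longrightarrow> y \<in> X" for N X
  proof -
    interpret X: graded N X by unfold_locales fact
    have "?b \<in> X"
      using that(3)[OF X.bottom_least(1) P'.bottom_least(1)] P'.bottom_least(2) that(2)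
        X.bottom_least(1) by blast
    then have "bottom X = ?b"
      using X.bottom_least P'.bottom_least that(2) by (meson antisym subsetD)
    moreover have "flag_sum (rk X) N X ?b = flag_sum ?r N X ?b"
      by (rule flag_sum_cong) (use rk_down_closed[OF that(2)] that(3) in blast)
    ultimately show ?thesis
      using X.ab_index_eq_flag_sum by simp
  qed
  \<comment> \<open>\<phi> may change ranks, but y belongs to the closed preimage of \<phi>(y), a
    down-closed subset of rank \<rho>(\<phi>(y)).\<close>
  have rk_le: "?r y \<le> ?\<rho> (\<phi> y)" if y: "y \<in> P'" for y
  proof -
    let ?X = "closed_preimage \<phi> P' (\<phi> y)"
    interpret X: graded "?\<rho> (\<phi> y)" ?X
      using near[OF \<phi>_in[OF y]] by unfold_locales (simp add: near_gorenstein_star_def)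
    have "y \<in> ?X" using y by (simp add: closed_preimage_def)
    moreover from this have "rk ?X y = ?r y"
      using rk_down_closed[OF closed(1)] down by blast
    ultimately show ?thesis
      using X.rk_le[of y] by simp
  qed
  have ab_closed: "ab_index (closed_preimage \<phi> P' s) = (\<Sum>t | t \<in> P \<and> t \<le> s. h t * e ^ (?\<rho> s - ?\<rho> t))"
    if s: "s \<in> P" for s
  proof -
    have "ab_index (closed_preimage \<phi> P' s) = flag_sum ?r (?\<rho> s) (closed_preimage \<phi> P' s) ?b"
      by (rule ab[OF _ closed(1) down]) (use near[OF s] in \<open>simp add: near_gorenstein_star_def\<close>)
    also have "\<dots> = (\<Sum>t | t \<in> P \<and> t \<le> s. h t * e ^ (?\<rho> s - ?\<rho> t))"
      unfolding h_def e_def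
    proof (rule flag_sum_fiberwise[OF P'.finite_P _ closed(1)])
      show "y \<in> closed_preimage \<phi> P' s" if "x \<in> closed_preimage \<phi> P' s" "y \<in> P'" "y \<le> x" for x y
        by (rule down[OF that])
      show "?\<rho> t \<le> ?\<rho> s" if "t \<in> {t \<in> P. t \<le> s}" for t
        using that rk_mono[OF P.finite_P, of t s] by auto
    qed (use \<phi>_in rk_le P.finite_P in \<open>auto simp: closed_preimage_def\<close>)
    finally show ?thesis .
  qed
  have ab_open: "ab_index (open_preimage \<phi> P' s) = (\<Sum>t | t \<in> P \<and> t < s. h t * e ^ (?\<rho> s - ?\<rho> t - 1))"
    if s: "s \<in> P" for s
  proof (cases "?\<rho> s = 0")
    \<comment> \<open>In rank 0 the boundary is empty and has rank -1, which the truncated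
      difference \<open>?\<rho> s - 1\<close> cannot express.\<close>
    case True
    then have "\<not> t < s" if "t \<in> P" for t
      using rk_less[OF P.finite_P that, of s] by auto
    then have "{t \<in> P. t < s} = {}" by auto
    moreover have "open_preimage \<phi> P' s = {}"
      using near[OF s] True by (simp add: near_gorenstein_star_def)
    ultimately show ?thesis by (simp only: ab_index_empty sum.empty)
  next
    case False
    have "ab_index (open_preimage \<phi> P' s) = flag_sum ?r (?\<rho> s - 1) (open_preimage \<phi> P' s) ?b"
      by (rule ab[OF _ closed(2) down']) (use near[OF s] False in \<open>simp add: near_gorenstein_star_def\<close>)
    also have "\<dots> = (\<Sum>t | t \<in> P \<and> t < s. h t * e ^ (?\<rho> s - 1 - ?\<rho> t))"
      unfolding h_def e_def
    proof (rule flag_sum_fiberwise[OF P'.finite_P _ closed(2)])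
      show "y \<in> open_preimage \<phi> P' s" if "x \<in> open_preimage \<phi> P' s" "y \<in> P'" "y \<le> x" for x y
        by (rule down'[OF that])
      show "?\<rho> t \<le> ?\<rho> s - 1" if "t \<in> {t \<in> P. t < s}" for t
        using that rk_less[OF P.finite_P, of t s] by auto
    qed (use \<phi>_in rk_le P.finite_P in \<open>auto simp: open_preimage_def\<close>)
    finally show ?thesis by (simp add: diff_commute)
  qed
  have Phi: "ab_index (closed_preimage \<phi> P' s) - ab_index (open_preimage \<phi> P' s) * pa
      = h s - (\<Sum>t | t \<in> P \<and> t < s. h t * e ^ (?\<rho> s - ?\<rho> t - 1) * pb)" if s: "s \<in> P" for s
  proof -
    let ?L = "{t \<in> P. t < s}"
    have "{t \<in> P. t \<le> s} = insert s ?L" using s by auto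
    then have "ab_index (closed_preimage \<phi> P' s) = h s + (\<Sum>t\<in>?L. h t * e ^ (?\<rho> s - ?\<rho> t))"
      using P.finite_P by (simp add: ab_closed[OF s])
    \<comment> \<open>One factor a - b is split off on the right. Its part with a is the ab-index of
      the open preimage times a, which \<Phi> subtracts; the part with b remains.\<close>
    also have "(\<Sum>t\<in>?L. h t * e ^ (?\<rho> s - ?\<rho> t))
        = (\<Sum>t\<in>?L. h t * e ^ (?\<rho> s - ?\<rho> t - 1) * pa - h t * e ^ (?\<rho> s - ?\<rho> t - 1) * pb)"
    proof (intro sum.cong refl)
      fix t assume "t \<in> ?L"
      then have "?\<rho> s - ?\<rho> t = Suc (?\<rho> s - ?\<rho> t - 1)"
        using rk_less[OF P.finite_P, of t s] by auto
      then have "e ^ (?\<rho> s - ?\<rho> t) = e ^ (?\<rho> s - ?\<rho> t - 1) * (pa - pb)"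
        by (metis e_def power_Suc2)
      then show "h t * e ^ (?\<rho> s - ?\<rho> t)
          = h t * e ^ (?\<rho> s - ?\<rho> t - 1) * pa - h t * e ^ (?\<rho> s - ?\<rho> t - 1) * pb"
        by (simp only: right_diff_distrib mult.assoc)
    qed
    finally show ?thesis
      by (simp add: ab_open[OF s] sum_subtractf sum_distrib_right)
  qed
  have "(\<Sum>s\<in>P. (ab_index (closed_preimage \<phi> P' s) - ab_index (open_preimage \<phi> P' s) * pa)
      * ab_index (upper_set P s))
    = (\<Sum>s\<in>P. h s * F s - (\<Sum>t | t \<in> P \<and> t < s. h t * e ^ (?\<rho> s - ?\<rho> t - 1) * pb * F s))"
    by (intro sum.cong refl)
      (simp add: Phi P.ab_index_upper_set F_def left_diff_distrib sum_distrib_right)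
  also have "\<dots> = (\<Sum>s\<in>P. h s * F s)
      - (\<Sum>s\<in>P. \<Sum>t | t \<in> P \<and> t < s. h t * e ^ (?\<rho> s - ?\<rho> t - 1) * pb * F s)"
    by (rule sum_subtractf)
  also have "(\<Sum>s\<in>P. \<Sum>t | t \<in> P \<and> t < s. h t * e ^ (?\<rho> s - ?\<rho> t - 1) * pb * F s)
      = (\<Sum>t\<in>P. \<Sum>s | s \<in> P \<and> t < s. h t * e ^ (?\<rho> s - ?\<rho> t - 1) * pb * F s)"
    by (rule sum.swap_restrict[OF P.finite_P P.finite_P])
  \<comment> \<open>After the exchange of summation, the subtracted sum at t is h(t) times all of
    the recursion for F(t) except its start term.\<close>
  also have "(\<Sum>s\<in>P. h s * F s) - \<dots> = (\<Sum>t\<in>P. h t * e ^ (n - ?\<rho> t))"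
    unfolding sum_subtractf[symmetric]
  proof (intro sum.cong refl)
    fix t assume t: "t \<in> P"
    have "(\<Sum>s | s \<in> P \<and> t < s. h t * e ^ (?\<rho> s - ?\<rho> t - 1) * pb * F s)
        = h t * (\<Sum>s | s \<in> P \<and> t < s. e ^ (?\<rho> s - ?\<rho> t - 1) * pb * F s)"
      by (simp add: sum_distrib_left mult.assoc)
    moreover have "F t = e ^ (n - ?\<rho> t) + (\<Sum>s | s \<in> P \<and> t < s. e ^ (?\<rho> s - ?\<rho> t - 1) * pb * F s)"
      using flag_sum_rec[OF P.finite_P t, of ?\<rho> n] by (simp add: F_def e_def)
    ultimately show "h t * F t - (\<Sum>s | s \<in> P \<and> t < s. h t * e ^ (?\<rho> s - ?\<rho> t - 1) * pb * F s)
        = h t * e ^ (n - ?\<rho> t)"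
      by (simp add: distrib_left)
  qed
  \<comment> \<open>The same fibrewise splitting, now for the whole source and N = n.\<close>
  also have "\<dots> = flag_sum ?r n P' ?b"
    unfolding h_def e_def
    by (rule flag_sum_fiberwise[OF P'.finite_P P.finite_P subset_refl, symmetric])
      (simp_all add: \<phi>_in rk_le P.rk_le)
  also have "\<dots> = ab_index P'"
    by (rule P'.ab_index_eq_flag_sum[symmetric])
  finally show ?thesis by (rule sym)
qed

theorem theorem2p7:
  fixes \<Pi>' :: "'a::order set" and \<Pi> :: "'b::order set"
    and \<phi> :: "'a \<Rightarrow> 'b" and n :: nat
  assumes "gorenstein_star n \<Pi>'" and "gorenstein_star n \<Pi>"
    and "subdivision n \<phi> \<Pi>' \<Pi>"
  shows "cd_index \<Pi>' =
    (\<Sum>\<sigma>\<in>\<Pi>. cd_Phi (closed_preimage \<phi> \<Pi>' \<sigma>) (open_preimage \<phi> \<Pi>' \<sigma>)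
              * cd_index (upper_set \<Pi> \<sigma>))"
proof -
  have "cd_subst (cd_Phi (closed_preimage \<phi> \<Pi>' \<sigma>) (open_preimage \<phi> \<Pi>' \<sigma>))
      = ab_index (closed_preimage \<phi> \<Pi>' \<sigma>) - ab_index (open_preimage \<phi> \<Pi>' \<sigma>) * pa"
    if "\<sigma> \<in> \<Pi>" for \<sigma>
    unfolding cd_Phi_def using assms(3) that
    by (intro cd_subst_to_cd near_gorenstein_star_cd_index[of "rk \<Pi> \<sigma>"]) (simp add: subdivision_def)
  moreover have "cd_subst (cd_index (upper_set \<Pi> \<sigma>)) = ab_index (upper_set \<Pi> \<sigma>)" if "\<sigma> \<in> \<Pi>" for \<sigma>
    unfolding cd_index_def by (intro cd_subst_to_cd gorenstein_star_cd_index[OF assms(2) that])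
  \<comment> \<open>All factors on the right lie in the image and \<open>cd_subst\<close> is a ring
    homomorphism, so the identity of ab-polynomials exhibits the preimage of the left side; by
    injectivity \<open>to_cd\<close> returns it.\<close>
  ultimately have "ab_index \<Pi>' = cd_subst (\<Sum>\<sigma>\<in>\<Pi>.
      cd_Phi (closed_preimage \<phi> \<Pi>' \<sigma>) (open_preimage \<phi> \<Pi>' \<sigma>) * cd_index (upper_set \<Pi> \<sigma>))"
    by (simp add: ab_index_subdivision[OF assms(3)] cd_subst_sum cd_subst_mult)
  then show ?thesis
    unfolding cd_index_def[of \<Pi>'] by simp
qed

end
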